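(* Let $(X,M,Y)$ be a random element of $\mathbb{R}^d\times\{0,1\}^d\times\{-1,1\}$ such that: $M$ is independent of $(X,Y)$; $\mathbb{P}(Y=1)=\mathbb{P}(Y=-1)$ and $X|Y=k\sim\mathcal{N}(\mu_k,\Sigma)$ for $k\in\{-1,1\}$, with $\mu_k\in\mathbb{R}^d$ and $\Sigma$ symmetric positive definite; the random variables $M_1,\dots,M_d$ are independent Bernoulli with parameter $\eta\in[0,1]$. Let $\widehat h$ be the pattern-by-pattern LDA classifier with known $\Sigma$ and estimated means $\widehat\mu_{\pm1}$, built on an i.i.d. incomplete sample of size $n$ (see context). Then $$\mathcal{R}_{\mathrm{mis}}(\widehat h)-\mathcal{R}_{\mathrm{mis}}(h^\star)\le\frac{2}{\sqrt{2\pi}}\left(\left(\frac{1+\eta}{2}\right)^n\frac{\|\mu\|_\infty^2\,d(1-\eta)}{\lambda_{\min}(\Sigma)}+\frac{4\kappa d}{n}\right)^{1/2}.$$ Consequently, there is a universal constant $C>0$ such that for all $n$ large enough (depending on the parameters of the model), $$\mathcal{R}_{\mathrm{mis}}(\widehat h)-\mathcal{R}_{\mathrm{mis}}(h^\star)\le C\sqrt{\kappa d/n}.$$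
   Context: $M_j=1$ means that $X_j$ is missing; $\mathrm{obs}(m)=\{j:m_j=0\}$; subscripts $\mathrm{obs}(m)$ denote subvectors, and $\Sigma_{\mathrm{obs}(m)}$ the submatrix of $\Sigma$ with rows and columns in $\mathrm{obs}(m)$. $Z=(X_{\mathrm{obs}(M)},M)$. Convention: $\mathrm{sign}(x)=1$ if $x\ge 0$, $-1$ otherwise. $\mathcal{D}_n=\{(X_{i,\mathrm{obs}(M_i)},M_i,Y_i)\}_{i=1}^n$ is an i.i.d. sample distributed as $(X_{\mathrm{obs}(M)},M,Y)$ and independent of the test point $(X,M,Y)$. For $k\in\{-1,1\}$, $1\le j\le d$, $$\widehat\mu_{k,j}=\frac{\sum_{i=1}^nX_{i,j}\mathbf{1}_{Y_i=k}\mathbf{1}_{M_{i,j}=0}}{\sum_{i=1}^n\mathbf{1}_{Y_i=k}\mathbf{1}_{M_{i,j}=0}}\qquad(0/0=0).$$ The classifier is $\widehat h(Z)=\sum_m\widehat h_m(X_{\mathrm{obs}(m)})\mathbf{1}_{M=m}$ with $$\widehat h_m(x_{\mathrm{obs}(m)})=\mathrm{sign}\Big(\big(\widehat\mu_{1,\mathrm{obs}(m)}-\widehat\mu_{-1,\mathrm{obs}(m)}\big)^\top\Sigma_{\mathrm{obs}(m)}^{-1}\Big(x_{\mathrm{obs}(m)}-\frac{\widehat\mu_{1,\mathrm{obs}(m)}+\widehat\mu_{-1,\mathrm{obs}(m)}}{2}\Big)\Big).$$ $\mathcal{R}_{\mathrm{mis}}(\widehat h)=\mathbb{P}(Y\ne\widehat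 h(Z))$, the probability being over both the sample and the test point, and $h^\star(Z)=\mathrm{sign}(\mathbb{E}[Y|Z])$ is the Bayes predictor, minimizing $\mathcal{R}_{\mathrm{mis}}$. $\|\mu\|_\infty=\max_{k\in\{-1,1\},1\le j\le d}|\mu_{k,j}|$, $\lambda_{\min}(\Sigma)$ is the smallest eigenvalue of $\Sigma$, and $\kappa=\max_{1\le i\le d}\Sigma_{i,i}/\lambda_{\min}(\Sigma)$. *)

theory Defs
  imports
    "HOL-Probability.Probability"
    "Jordan_Normal_Form.Char_Poly"
    "Jordan_Normal_Form.Gauss_Jordan_Elimination"
    "Jordan_Normal_Form.DL_Submatrix"
begin

unbundle no vec_syntax
unbundle no inner_syntax

text \<open>
  The dimension \<open>d\<close> is quantified inside the statement (below a universal constant), so points of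
  \<open>\<real>\<^sup>d\<close> are extensional functions on \<open>{..<d}\<close> when they carry a
  measure, and are turned into vectors over matrices of the same varying dimension for linear
  algebra. Coordinates are numbered from 0.

  A random element \<open>(X, M, Y)\<close> is given by its law \<open>Q\<close>, i.e. it is realised as the identity
  on the canonical space below; the risks depend on the law only. In a mask, \<open>True\<close> at \<open>j\<close>
  stands for \<open>M\<^sub>j = 1\<close>, i.e. coordinate \<open>j\<close> is missing.
\<close>

type_synonym mask = "nat \<Rightarrow> bool"
type_synonym full_point = "(nat \<Rightarrow> real) \<times> mask \<times> int"
type_synonym obs_point = "(nat \<Rightarrow> real) \<times> mask"

abbreviation covariate_space :: "nat \<Rightarrow> (nat \<Rightarrow> real) measure" where
  "covariate_space d \<equiv> PiM {..<d} (\<lambda>_. borel)"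

abbreviation mask_space :: "nat \<Rightarrow> mask measure" where
  "mask_space d \<equiv> PiM {..<d} (\<lambda>_. count_space UNIV)"

abbreviation label_space :: "int measure" where
  "label_space \<equiv> count_space {-1, 1}"

abbreviation covariate :: "full_point \<Rightarrow> nat \<Rightarrow> real" where
  "covariate \<omega> \<equiv> fst \<omega>"

abbreviation missing :: "full_point \<Rightarrow> mask" where
  "missing \<omega> \<equiv> fst (snd \<omega>)"

abbreviation label :: "full_point \<Rightarrow> int" where
  "label \<omega> \<equiv> snd (snd \<omega>)"

definition inv_mat :: "real mat \<Rightarrow> real mat" where
  "inv_mat A = the (mat_inverse A)"

definition sym_pos_def :: "nat \<Rightarrow> real mat \<Rightarrow> bool" where
  "sym_pos_def d A \<longleftrightarrow> A \<in> carrier_mat d d \<and> transpose_mat A = A \<and>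
     (\<forall>v \<in> carrier_vec d. v \<noteq> 0\<^sub>v d \<longrightarrow> v \<bullet> (A *\<^sub>v v) > 0)"

definition mvn_density :: "nat \<Rightarrow> real vec \<Rightarrow> real mat \<Rightarrow> (nat \<Rightarrow> real) \<Rightarrow> real" where
  "mvn_density d \<mu> \<Sigma> x =
     exp (- ((vec d x - \<mu>) \<bullet> (inv_mat \<Sigma> *\<^sub>v (vec d x - \<mu>))) / 2)
     / sqrt ((2 * pi) ^ d * Determinant.det \<Sigma>)"

locale lda_mcar_model = prob_space Q
  for d :: nat and \<eta> :: real and \<mu> :: "int \<Rightarrow> real vec" and \<Sigma> :: "real mat"
    and Q :: "full_point measure" +
  assumes dim_pos: "d \<ge> 1"
    and sets_law: "sets Q = sets (covariate_space d \<Otimes>\<^sub>M (mask_space d \<Otimes>\<^sub>M label_space))"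
    and eta_range: "0 \<le> \<eta>" "\<eta> \<le> 1"
    and mean_dim: "\<And>k. k \<in> {-1, 1} \<Longrightarrow> \<mu> k \<in> carrier_vec d"
    and cov_pos_def: "sym_pos_def d \<Sigma>"
    and mask_indep_data:
      "indep_set
         (sets (vimage_algebra (space Q) missing (mask_space d)))
         (sets (vimage_algebra (space Q) (\<lambda>\<omega>. (covariate \<omega>, label \<omega>))
                  (covariate_space d \<Otimes>\<^sub>M label_space)))"
    and balanced: "prob {\<omega> \<in> space Q. label \<omega> = 1} = prob {\<omega> \<in> space Q. label \<omega> = -1}"
    and class_gaussian: "\<And>k. k \<in> {-1, 1} \<Longrightarrow>
      distributed (uniform_measure Q {\<omega> \<in> space Q. label \<omega> = k}) (PiM {..<d} (\<lambda>_. lborel))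
        covariate (\<lambda>x. ennreal (mvn_density d (\<mu> k) \<Sigma> x))"
    and mask_bernoulli: "\<And>j. j < d \<Longrightarrow>
      distr Q (count_space UNIV) (\<lambda>\<omega>. missing \<omega> j) = measure_pmf (bernoulli_pmf \<eta>)"
    and mask_indep: "indep_vars (\<lambda>_. count_space UNIV) (\<lambda>j \<omega>. missing \<omega> j) {..<d}"

definition obs :: "nat \<Rightarrow> mask \<Rightarrow> nat set" where
  "obs d m = {j. j < d \<and> \<not> m j}"

text \<open>\<open>Z = (X\<^bsub>obs(M)\<^esub>, M)\<close>, where the subvector is the restriction to the
  observed coordinates.\<close>

definition observe :: "nat \<Rightarrow> full_point \<Rightarrow> obs_point" where
  "observe d \<omega> = (restrict (covariate \<omega>) (obs d (missing \<omega>)), missing \<omega>)"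

abbreviation obs_space :: "nat \<Rightarrow> obs_point measure" where
  "obs_space d \<equiv> covariate_space d \<Otimes>\<^sub>M mask_space d"

definition incomplete_law :: "nat \<Rightarrow> full_point measure \<Rightarrow> (obs_point \<times> int) measure" where
  "incomplete_law d Q = distr Q (obs_space d \<Otimes>\<^sub>M label_space) (\<lambda>\<omega>. (observe d \<omega>, label \<omega>))"

definition sign :: "real \<Rightarrow> int" where
  "sign x = (if x \<ge> 0 then 1 else -1)"

type_synonym sample = "nat \<Rightarrow> obs_point \<times> int"

definition mu_hat :: "nat \<Rightarrow> sample \<Rightarrow> int \<Rightarrow> nat \<Rightarrow> real" where
  "mu_hat n D k j =
     (\<Sum>i<n. fst (fst (D i)) j * of_bool (snd (D i) = k) * of_bool (\<not> snd (fst (D i)) j))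
     / (\<Sum>i<n. of_bool (snd (D i) = k) * of_bool (\<not> snd (fst (D i)) j))"

text \<open>\<open>pick I i\<close> is the \<open>i\<close>-th element of \<open>I\<close> in increasing order, the indexing used
  by \<open>submatrix\<close>.\<close>

definition subvec :: "(nat \<Rightarrow> real) \<Rightarrow> nat set \<Rightarrow> real vec" where
  "subvec x I = vec (card I) (\<lambda>i. x (pick I i))"

definition h_hat_pattern ::
  "nat \<Rightarrow> real mat \<Rightarrow> nat \<Rightarrow> sample \<Rightarrow> mask \<Rightarrow> (nat \<Rightarrow> real) \<Rightarrow> int" where
  "h_hat_pattern d \<Sigma> n D m x =
     (let I = obs d m;
          \<mu>1 = subvec (mu_hat n D 1) I;
          \<mu>2 = subvec (mu_hat n D (-1)) I
      in sign ((\<mu>1 - \<mu>2) \<bullet>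
           (inv_mat (submatrix \<Sigma> I I) *\<^sub>v (subvec x I - (1/2) \<cdot>\<^sub>v (\<mu>1 + \<mu>2)))))"

definition h_hat :: "nat \<Rightarrow> real mat \<Rightarrow> nat \<Rightarrow> sample \<Rightarrow> obs_point \<Rightarrow> int" where
  "h_hat d \<Sigma> n D z = h_hat_pattern d \<Sigma> n D (snd z) (fst z)"

text \<open>The probability is over the sample and an independent test point.\<close>

definition risk_h_hat :: "nat \<Rightarrow> real mat \<Rightarrow> nat \<Rightarrow> full_point measure \<Rightarrow> real" where
  "risk_h_hat d \<Sigma> n Q =
     (let P = PiM {..<n} (\<lambda>_. incomplete_law d Q) \<Otimes>\<^sub>M Q
      in measure P {(D, \<omega>) \<in> space P. label \<omega> \<noteq> h_hat d \<Sigma> n D (observe d \<omega>)})"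

definition h_star :: "nat \<Rightarrow> full_point measure \<Rightarrow> full_point \<Rightarrow> int" where
  "h_star d Q \<omega> = sign (real_cond_exp Q (vimage_algebra (space Q) (observe d) (obs_space d))
                            (\<lambda>\<omega>'. of_int (label \<omega>')) \<omega>)"

definition risk_h_star :: "nat \<Rightarrow> full_point measure \<Rightarrow> real" where
  "risk_h_star d Q = measure Q {\<omega> \<in> space Q. label \<omega> \<noteq> h_star d Q \<omega>}"

definition mu_norm :: "nat \<Rightarrow> (int \<Rightarrow> real vec) \<Rightarrow> real" where
  "mu_norm d \<mu> = Max {\<bar>vec_index (\<mu> k) j\<bar> | k j. k \<in> {-1, 1} \<and> j < d}"

definition lambda_min :: "real mat \<Rightarrow> real" where
  "lambda_min A = Min {l. eigenvalue A l}"

definition kappa :: "nat \<Rightarrow> real mat \<Rightarrow> real" where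
  "kappa d \<Sigma> = Max {\<Sigma> $$ (i, i) | i. i < d} / lambda_min \<Sigma>"

end

theory Submission
  imports Defs
begin

text \<open>
  Fix the sample and a missingness pattern with observed set \<open>I\<close>. On this pattern the classifier is
  the Bayes rule of another balanced two-class Gaussian problem, in which the class means have been
  moved so that they agree on \<open>I\<close> with the estimated ones. Comparing it with any rule that sees only
  \<open>(X\<^bsub>obs(M)\<^esub>, M)\<close> (the Bayes predictor is one), the excess risk on the pattern is therefore at
  most the price of moving the two means, that is, the sum over the classes of the total variation
  distance between \<open>N(\<mu>\<^sub>k, \<Sigma>)\<close> and \<open>N(\<nu>\<^sub>k, \<Sigma>)\<close>. This distance is at most the Mahalanobis
  length of \<open>\<nu>\<^sub>k - \<mu>\<^sub>k\<close> divided by \<open>sqrt (2 * pi)\<close>, hence at most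
  \<open>\<parallel>\<nu>\<^sub>k - \<mu>\<^sub>k\<parallel> / sqrt (2 * pi * \<lambda>\<^sub>m\<^sub>i\<^sub>n)\<close>. This is \<open>plug_in_excess_le\<close>.

  All computations take place in the full space \<open>\<real>\<^sup>d\<close>, and marginal densities never appear. Two facts
  replace them. The probability of an event that depends on the coordinates in \<open>I\<close> alone depends on
  the mean through its coordinates in \<open>I\<close> alone, because changing the other ones is a translation
  that leaves the event invariant (\<open>mvn_cylinder_cong\<close>). And the classifier's direction
  \<open>\<Sigma>\<^sub>I\<^sup>-\<^sup>1 (a - b)\<close>, extended by zero to \<open>w\<close> in \<open>\<real>\<^sup>d\<close>, satisfies \<open>(\<Sigma> w)\<^sub>I = a - b\<close>, while the
  density ratio of \<open>N(\<nu> + \<Sigma> w, \<Sigma>)\<close> to \<open>N(\<nu>, \<Sigma>)\<close> is the exponential of an affine function with slope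
  \<open>w\<close> (\<open>mvn_density_shift\<close>): a function of the observed coordinates, and exactly the discriminant score.
  The same ratio formula identifies the law of a linear functional as a one-dimensional normal law
  (\<open>distr_linear_functional\<close>), which yields the total variation bound and the first two moments.

  It remains to average over the pattern and the sample. Since the mask is independent of the data,
  the expected squared error of the means on a random pattern is the sum over the coordinates of
  \<open>1 - \<eta>\<close> times the mean squared error of \<open>mu_hat\<close>. The latter is an empirical mean over a
  Binomial number of entries, with success probability \<open>p = (1 - \<eta>) / 2\<close>: the event that there is no entry contributes
  \<open>(1 - p)\<^sup>n \<mu>\<^sup>2\<close>, the other one a variance that \<open>p * E[1{N > 0} / N] \<le> 2 / (n + 1)\<close> controls
  (\<open>observed_mean_mse\<close>). The square root comes out of the expectation through
  \<open>sqrt t \<le> c / 2 + t / (2 * c)\<close>, with \<open>c\<close> the square root of the final bound. For the second claim, the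
  term in \<open>((1 + \<eta>) / 2)\<^sup>n\<close> vanishes faster than \<open>1 / n\<close>, or is zero when \<open>\<eta> = 1\<close>.
\<close>

section \<open>Positive definite matrices and the smallest eigenvalue\<close>

lemma inv_mat_inverse:
  assumes A: "(A :: real mat) \<in> carrier_mat n n" and inj: "\<And>v. v \<in> carrier_vec n \<Longrightarrow> A *\<^sub>v v = 0\<^sub>v n \<Longrightarrow> v = 0\<^sub>v n"
  shows "inv_mat A \<in> carrier_mat n n" "A * inv_mat A = 1\<^sub>m n" "inv_mat A * A = 1\<^sub>m n"
proof -
  have "det A \<noteq> 0"
    using det_0_iff_vec_prod_zero_field[OF A] inj by blast
  then have "A \<in> Units (ring_mat TYPE(real) n ())"
    by (rule det_non_zero_imp_unit[OF A])
  then obtain B where "mat_inverse A = Some B"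
    using mat_inverse(1)[OF A, of "()"] by (cases "mat_inverse A") auto
  with mat_inverse(2)[OF A this]
  show "inv_mat A \<in> carrier_mat n n" "A * inv_mat A = 1\<^sub>m n" "inv_mat A * A = 1\<^sub>m n"
    by (auto simp: inv_mat_def)
qed

lemma scalar_prod_mult_mat_vec_swap:
  assumes "(A :: 'a :: comm_semiring_0 mat) \<in> carrier_mat n n" "transpose_mat A = A"
    and "u \<in> carrier_vec n" "v \<in> carrier_vec n"
  shows "u \<bullet> (A *\<^sub>v v) = v \<bullet> (A *\<^sub>v u)"
  using transpose_vec_mult_scalar[OF assms(1) assms(4) assms(3)] assms
  by (metis mult_mat_vec_carrier comm_scalar_prod)

lemma scalar_prod_diff_scaled:
  assumes "u \<in> carrier_vec n" "v \<in> carrier_vec n" "w \<in> carrier_vec n" "z \<in> carrier_vec n"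
  shows "(u - (s :: real) \<cdot>\<^sub>v v) \<bullet> (w - s \<cdot>\<^sub>v z)
    = u \<bullet> w - s * (u \<bullet> z) - s * (v \<bullet> w) + s * s * (v \<bullet> z)"
proof -
  have "(u - s \<cdot>\<^sub>v v) \<bullet> (w - s \<cdot>\<^sub>v z)
    = (\<Sum>i<n. u $ i * w $ i - s * (u $ i * z $ i) - s * (v $ i * w $ i) + s * s * (v $ i * z $ i))"
    unfolding scalar_prod_def using assms
    by (intro sum.cong) (auto simp: algebra_simps)
  also have "\<dots> = u \<bullet> w - s * (u \<bullet> z) - s * (v \<bullet> w) + s * s * (v \<bullet> z)"
    unfolding scalar_prod_def using assms
    by (simp add: sum.distrib sum_subtractf sum_distrib_left atLeast0LessThan)
  finally show ?thesis .
qed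

lemma scalar_prod_mat_sum:
  assumes "A \<in> carrier_mat n n" "u \<in> carrier_vec n" "v \<in> carrier_vec n"
  shows "u \<bullet> (A *\<^sub>v v) = (\<Sum>i<n. \<Sum>j<n. u $ i * A $$ (i,j) * v $ j)"
  using assms by (auto simp: scalar_prod_def sum_distrib_left mult.assoc atLeast0LessThan intro!: sum.cong)

lemma quadratic_form_bounded:
  assumes A: "(A :: real mat) \<in> carrier_mat n n"
  shows "\<exists>C>0. \<forall>v \<in> carrier_vec n. v \<bullet> (A *\<^sub>v v) \<le> C * (v \<bullet> v)"
proof (intro exI conjI ballI)
  let ?C = "1 + (\<Sum>i<n. \<Sum>j<n. \<bar>A $$ (i,j)\<bar>)"
  show "?C > 0" by (smt (verit) abs_ge_zero sum_nonneg)
  fix v :: "real vec" assume v: "v \<in> carrier_vec n"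
  have vv: "v \<bullet> v = (\<Sum>i<n. (v $ i)\<^sup>2)"
    using v by (auto simp: scalar_prod_def power2_eq_square atLeast0LessThan)
  have le: "\<bar>v $ i\<bar> * \<bar>v $ j\<bar> \<le> v \<bullet> v" if "i < n" "j < n" for i j
  proof -
    have "(v $ l)\<^sup>2 \<le> v \<bullet> v" if "l < n" for l
      unfolding vv by (rule member_le_sum) (use that in auto)
    from this[OF that(1)] this[OF that(2)]
    show ?thesis using sum_squares_bound[of "\<bar>v $ i\<bar>" "\<bar>v $ j\<bar>"] by simp
  qed
  have "v \<bullet> (A *\<^sub>v v) = (\<Sum>i<n. \<Sum>j<n. v $ i * A $$ (i,j) * v $ j)"
    by (rule scalar_prod_mat_sum[OF A v v])
  also have "\<dots> \<le> (\<Sum>i<n. \<Sum>j<n. \<bar>A $$ (i,j)\<bar> * (v \<bullet> v))"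
  proof (intro sum_mono)
    fix i j assume "i \<in> {..<n}" "j \<in> {..<n}"
    then have "\<bar>A $$ (i,j)\<bar> * (\<bar>v $ i\<bar> * \<bar>v $ j\<bar>) \<le> \<bar>A $$ (i,j)\<bar> * (v \<bullet> v)"
      by (intro mult_left_mono le) auto
    moreover have "v $ i * A $$ (i,j) * v $ j \<le> \<bar>A $$ (i,j)\<bar> * (\<bar>v $ i\<bar> * \<bar>v $ j\<bar>)"
      using abs_ge_self[of "v $ i * A $$ (i,j) * v $ j"] by (simp add: abs_mult mult_ac)
    ultimately show "v $ i * A $$ (i,j) * v $ j \<le> \<bar>A $$ (i,j)\<bar> * (v \<bullet> v)" by linarith
  qed
  also have "\<dots> = (\<Sum>i<n. \<Sum>j<n. \<bar>A $$ (i,j)\<bar>) * (v \<bullet> v)"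
    by (simp add: sum_distrib_right)
  also have "\<dots> \<le> ?C * (v \<bullet> v)"
    by (intro mult_right_mono) (auto simp: vv sum_nonneg)
  finally show "v \<bullet> (A *\<^sub>v v) \<le> ?C * (v \<bullet> v)" .
qed

text \<open>
  With \<open>y = B\<^sup>-\<^sup>1 v\<close>, expanding \<open>0 \<le> (v - s y)\<^sup>T B (v - s y)\<close> gives
  \<open>v\<^sup>T B v \<ge> 2 s \<parallel>v\<parallel>\<^sup>2 - s\<^sup>2 v\<^sup>T B\<^sup>-\<^sup>1 v\<close>; a small \<open>s\<close> lets the first term win. This replaces a
  compactness argument on the unit sphere.
\<close>

lemma psd_injective_coercive:
  assumes B: "(B :: real mat) \<in> carrier_mat n n" and sym: "transpose_mat B = B"
    and psd: "\<And>v. v \<in> carrier_vec n \<Longrightarrow> 0 \<le> v \<bullet> (B *\<^sub>v v)"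
    and inj: "\<And>v. v \<in> carrier_vec n \<Longrightarrow> B *\<^sub>v v = 0\<^sub>v n \<Longrightarrow> v = 0\<^sub>v n"
  shows "\<exists>c>0. \<forall>v \<in> carrier_vec n. c * (v \<bullet> v) \<le> v \<bullet> (B *\<^sub>v v)"
proof -
  note inv = inv_mat_inverse[OF B inj]
  obtain C where C: "C > 0" "\<And>v. v \<in> carrier_vec n \<Longrightarrow> v \<bullet> (inv_mat B *\<^sub>v v) \<le> C * (v \<bullet> v)"
    using quadratic_form_bounded[OF inv(1)] by blast
  have "(1/C) * (v \<bullet> v) \<le> v \<bullet> (B *\<^sub>v v)" if v: "v \<in> carrier_vec n" for v
  proof -
    define y where "y = inv_mat B *\<^sub>v v"
    have y: "y \<in> carrier_vec n" and By: "B *\<^sub>v y = v"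
      using v inv by (auto simp: y_def assoc_mult_mat_vec[OF B inv(1) v, symmetric])
    define s where "s = 1 / C"
    have "0 \<le> (v - s \<cdot>\<^sub>v y) \<bullet> (B *\<^sub>v (v - s \<cdot>\<^sub>v y))"
      by (rule psd) (use v y in auto)
    also have "B *\<^sub>v (v - s \<cdot>\<^sub>v y) = B *\<^sub>v v - s \<cdot>\<^sub>v v"
      using B v y By by (simp add: mult_minus_distrib_mat_vec mult_mat_vec)
    also have "(v - s \<cdot>\<^sub>v y) \<bullet> (B *\<^sub>v v - s \<cdot>\<^sub>v v)
      = v \<bullet> (B *\<^sub>v v) - s * (v \<bullet> v) - s * (y \<bullet> (B *\<^sub>v v)) + s * s * (y \<bullet> v)"
      using B v y by (intro scalar_prod_diff_scaled) auto
    also have "y \<bullet> (B *\<^sub>v v) = v \<bullet> v"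
      using scalar_prod_mult_mat_vec_swap[OF B sym y v] By by simp
    finally have "0 \<le> v \<bullet> (B *\<^sub>v v) - 2 * s * (v \<bullet> v) + s * s * (y \<bullet> v)" by simp
    moreover have "y \<bullet> v \<le> C * (v \<bullet> v)"
      using C(2)[OF v] comm_scalar_prod[OF v y] by (simp add: y_def)
    then have "s * s * (y \<bullet> v) \<le> s * s * (C * (v \<bullet> v))" by (intro mult_left_mono) auto
    moreover have "s * s * (C * (v \<bullet> v)) = s * (v \<bullet> v)" using C(1) by (simp add: s_def)
    ultimately show ?thesis by (simp add: s_def)
  qed
  then show ?thesis using C(1) by (intro exI[of _ "1/C"]) auto
qed

lemma finite_eigenvalues: "finite {l :: real. eigenvalue A l}" if "A \<in> carrier_mat n n"
proof -
  have "char_poly A \<noteq> 0" using degree_monic_char_poly[OF that] by auto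
  from poly_roots_finite[OF this] show ?thesis
    by (simp add: eigenvalue_root_char_poly[OF that])
qed

lemma sym_pos_defD:
  assumes "sym_pos_def n A"
  shows "A \<in> carrier_mat n n" "transpose_mat A = A"
    "\<And>v. v \<in> carrier_vec n \<Longrightarrow> v \<noteq> 0\<^sub>v n \<Longrightarrow> 0 < v \<bullet> (A *\<^sub>v v)"
    "\<And>v. v \<in> carrier_vec n \<Longrightarrow> 0 \<le> v \<bullet> (A *\<^sub>v v)"
    "\<And>v. v \<in> carrier_vec n \<Longrightarrow> A *\<^sub>v v = 0\<^sub>v n \<Longrightarrow> v = 0\<^sub>v n"
proof -
  show A: "A \<in> carrier_mat n n" and "transpose_mat A = A"
    and pos: "\<And>v. v \<in> carrier_vec n \<Longrightarrow> v \<noteq> 0\<^sub>v n \<Longrightarrow> 0 < v \<bullet> (A *\<^sub>v v)"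
    using assms by (auto simp: sym_pos_def_def)
  show "0 \<le> v \<bullet> (A *\<^sub>v v)" if "v \<in> carrier_vec n" for v
  proof (cases "v = 0\<^sub>v n")
    case True
    then show ?thesis using A by (auto intro!: sum_nonneg simp: scalar_prod_def)
  next
    case False
    then show ?thesis using pos[OF that False] by simp
  qed
  show "v = 0\<^sub>v n" if "v \<in> carrier_vec n" "A *\<^sub>v v = 0\<^sub>v n" for v
    using pos[OF that(1)] that by (cases "v = 0\<^sub>v n") auto
qed

lemma inv_mat_spd:
  assumes "sym_pos_def n A"
  shows "inv_mat A \<in> carrier_mat n n" "A * inv_mat A = 1\<^sub>m n" "inv_mat A * A = 1\<^sub>m n"
  using inv_mat_inverse[OF sym_pos_defD(1)[OF assms] sym_pos_defD(5)[OF assms]] by auto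

text \<open>
  Let \<open>l\<close> be the infimum of the Rayleigh quotient. Then \<open>A - l I\<close> is positive semidefinite; were it
  injective, it would be coercive, and \<open>l\<close> could be increased.
\<close>

lemma rayleigh_infimum_eigenvalue:
  assumes spd: "sym_pos_def n A" and n: "n \<ge> 1"
  shows "\<exists>l. eigenvalue A l \<and> (\<forall>v \<in> carrier_vec n. l * (v \<bullet> v) \<le> v \<bullet> (A *\<^sub>v v))"
proof -
  note A = sym_pos_defD[OF spd]
  define S where "S = {v \<bullet> (A *\<^sub>v v) / (v \<bullet> v) | v. v \<in> carrier_vec n \<and> v \<noteq> 0\<^sub>v n}"
  define l where "l = Inf S"
  have vv: "0 < v \<bullet> v" if "v \<in> carrier_vec n" "v \<noteq> 0\<^sub>v n" for v :: "real vec"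
  proof -
    from that obtain i where "i < n" "v $ i \<noteq> 0" by (metis carrier_vecD eq_vecI index_zero_vec)
    then show ?thesis using that(1) unfolding scalar_prod_def
      by (intro sum_pos2[of _ i]) (auto simp: zero_less_mult_iff)
  qed
  have "unit_vec n 0 \<bullet> (A *\<^sub>v unit_vec n 0) / (unit_vec n 0 \<bullet> unit_vec n 0) \<in> S"
    unfolding S_def using n by (intro CollectI exI[of _ "unit_vec n 0"]) (auto dest!: arg_cong[where f = "\<lambda>v. v $ 0"])
  then have ne: "S \<noteq> {}" by blast
  have bdd: "bdd_below S"
    by (rule bdd_belowI[of _ 0]) (auto simp: S_def vv less_imp_le A(4))
  have ray: "l * (v \<bullet> v) \<le> v \<bullet> (A *\<^sub>v v)" if v: "v \<in> carrier_vec n" for v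
  proof (cases "v = 0\<^sub>v n")
    case True then show ?thesis using A(1) by (simp add: scalar_prod_def)
  next
    case False
    then have "l \<le> v \<bullet> (A *\<^sub>v v) / (v \<bullet> v)"
      unfolding l_def using v by (intro cInf_lower bdd) (auto simp: S_def)
    then show ?thesis using vv[OF v False] by (simp add: field_simps)
  qed
  define B where "B = A - l \<cdot>\<^sub>m 1\<^sub>m n"
  have B: "B \<in> carrier_mat n n" unfolding B_def by (intro minus_carrier_mat smult_carrier_mat one_carrier_mat)
  have Bv: "B *\<^sub>v v = A *\<^sub>v v - l \<cdot>\<^sub>v v" if "v \<in> carrier_vec n" for v
  proof -
    have "(l \<cdot>\<^sub>m 1\<^sub>m n) *\<^sub>v v = l \<cdot>\<^sub>v v"
      using that by (intro eq_vecI) auto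
    then show ?thesis
      using minus_mult_distrib_mat_vec[OF A(1) smult_carrier_mat[OF one_carrier_mat] that] by (simp add: B_def)
  qed
  have vBv: "v \<bullet> (B *\<^sub>v v) = v \<bullet> (A *\<^sub>v v) - l * (v \<bullet> v)" if "v \<in> carrier_vec n" for v
    using A(1) that by (simp add: Bv scalar_prod_minus_distrib[of _ n])
  have "eigenvalue A l"
  proof (rule ccontr)
    assume *: "\<not> eigenvalue A l"
    have sym: "transpose_mat B = B"
    proof -
      have "transpose_mat (l \<cdot>\<^sub>m 1\<^sub>m n) = l \<cdot>\<^sub>m 1\<^sub>m n" by (intro eq_matI) auto
      then show ?thesis
        using transpose_minus[OF A(1) smult_carrier_mat[OF one_carrier_mat, of l]] A(2) by (simp add: B_def)
    qed
    have inj: "v = 0\<^sub>v n" if v: "v \<in> carrier_vec n" "B *\<^sub>v v = 0\<^sub>v n" for v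
    proof (rule ccontr)
      assume "v \<noteq> 0\<^sub>v n"
      moreover have "A *\<^sub>v v = l \<cdot>\<^sub>v v"
        using v(2) A(1) v(1) unfolding Bv[OF v(1)] vec_eq_iff by auto
      ultimately have "eigenvector A v l" using A(1) v(1) by (simp add: eigenvector_def)
      then show False using * by (auto simp: eigenvalue_def)
    qed
    obtain c where c: "c > 0" "\<And>v. v \<in> carrier_vec n \<Longrightarrow> c * (v \<bullet> v) \<le> v \<bullet> (B *\<^sub>v v)"
      using psd_injective_coercive[OF B sym _ inj] ray vBv by (metis diff_ge_0_iff_ge)
    have "l + c \<le> Inf S"
    proof (rule cInf_greatest[OF ne])
      fix x assume "x \<in> S"
      then obtain v where v: "v \<in> carrier_vec n" "v \<noteq> 0\<^sub>v n" "x = v \<bullet> (A *\<^sub>v v) / (v \<bullet> v)"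
        by (auto simp: S_def)
      then show "l + c \<le> x"
        using c(2)[OF v(1)] vBv[OF v(1)] vv[OF v(1,2)] by (simp add: pos_le_divide_eq distrib_right)
    qed
    then show False using c(1) by (simp add: l_def)
  qed
  with ray show ?thesis by blast
qed

lemma lambda_min_spd:
  assumes spd: "sym_pos_def n A" and n: "n \<ge> 1"
  shows "lambda_min A > 0" "\<And>v. v \<in> carrier_vec n \<Longrightarrow> lambda_min A * (v \<bullet> v) \<le> v \<bullet> (A *\<^sub>v v)"
proof -
  note A = sym_pos_defD[OF spd]
  obtain l where l: "eigenvalue A l" "\<And>v. v \<in> carrier_vec n \<Longrightarrow> l * (v \<bullet> v) \<le> v \<bullet> (A *\<^sub>v v)"
    using rayleigh_infimum_eigenvalue[OF assms] by blast
  note fin = finite_eigenvalues[OF A(1)]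
  have nonneg: "0 \<le> v \<bullet> v" for v :: "real vec" by (auto simp: scalar_prod_def intro!: sum_nonneg)
  have "lambda_min A \<in> {l. eigenvalue A l}"
    unfolding lambda_min_def using l(1) by (intro Min_in fin) auto
  then obtain v where v: "v \<in> carrier_vec n" "v \<noteq> 0\<^sub>v n" "A *\<^sub>v v = lambda_min A \<cdot>\<^sub>v v"
    using A(1) by (auto simp: eigenvalue_def eigenvector_def)
  have "0 < lambda_min A * (v \<bullet> v)" using A(3)[OF v(1,2)] v by simp
  then show "lambda_min A > 0" using nonneg[of v] by (simp add: zero_less_mult_iff)
  have "lambda_min A \<le> l" unfolding lambda_min_def using l(1) by (intro Min_le fin) auto
  then show "lambda_min A * (v \<bullet> v) \<le> v \<bullet> (A *\<^sub>v v)" if "v \<in> carrier_vec n" for v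
    using l(2)[OF that] mult_right_mono[OF _ nonneg[of v]] by (meson order_trans)
qed

text \<open>
  With \<open>v = A z\<close> the left-hand side is \<open>v\<^sup>T A\<^sup>-\<^sup>1 v\<close>, so this compares Mahalanobis and Euclidean lengths.
\<close>

lemma inverse_quadratic_form_le:
  assumes spd: "sym_pos_def n A" and n: "n \<ge> 1" and z: "z \<in> carrier_vec n"
  shows "z \<bullet> (A *\<^sub>v z) \<le> ((A *\<^sub>v z) \<bullet> (A *\<^sub>v z)) / lambda_min A"
proof -
  note A = sym_pos_defD[OF spd] and l = lambda_min_spd[OF spd n]
  let ?l = "lambda_min A" and ?v = "A *\<^sub>v z"
  have v: "?v \<in> carrier_vec n" using A(1) z by auto
  have "0 \<le> (?v - ?l \<cdot>\<^sub>v z) \<bullet> (?v - ?l \<cdot>\<^sub>v z)" by (auto simp: scalar_prod_def intro!: sum_nonneg)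
  also have "\<dots> = ?v \<bullet> ?v - 2 * ?l * (z \<bullet> ?v) + ?l * (?l * (z \<bullet> z))"
    using scalar_prod_diff_scaled[OF v z v z] comm_scalar_prod[OF v z] by simp
  also have "\<dots> \<le> ?v \<bullet> ?v - 2 * ?l * (z \<bullet> ?v) + ?l * (z \<bullet> ?v)"
    using l(1) l(2)[OF z] by (intro add_left_mono mult_left_mono) auto
  finally show ?thesis using l(1) by (simp add: field_simps)
qed

section \<open>Principal submatrices and the discriminant direction\<close>

lemma bij_betw_pick:
  assumes fin: "finite I"
  shows "bij_betw (pick I) {..<card I} I"
proof (rule bij_betw_imageI)
  show "inj_on (pick I) {..<card I}"
    by (intro inj_onI) (metis card_pick lessThan_iff)
  have "x \<in> pick I ` {..<card I}" if "x \<in> I" for x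
  proof (rule image_eqI)
    show "x = pick I (card {a\<in>I. a < x})" using pick_card_in_set[OF that] by simp
    show "card {a\<in>I. a < x} \<in> {..<card I}"
      using that fin by (auto intro!: psubset_card_mono)
  qed
  then show "pick I ` {..<card I} = I"
    by (auto intro: pick_in_set_le)
qed

text \<open>
  The rank \<open>card {a\<in>I. a < j}\<close> of \<open>j\<close> in \<open>I\<close> inverts \<open>pick I\<close>.
\<close>

definition zero_extend :: "nat \<Rightarrow> nat set \<Rightarrow> real vec \<Rightarrow> real vec" where
  "zero_extend d I w = vec d (\<lambda>j. if j \<in> I then w $ (card {a\<in>I. a < j}) else 0)"

lemma zero_extend_carrier [simp]: "zero_extend d I w \<in> carrier_vec d"
  by (simp add: zero_extend_def)

lemma sum_zero_extend:
  assumes I: "I \<subseteq> {..<d}"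
  shows "(\<Sum>j<d. zero_extend d I w $ j * x j) = (\<Sum>i<card I. w $ i * x (pick I i))"
proof -
  have fin: "finite I" using I finite_subset by blast
  have idx: "card {a\<in>I. a < pick I i} = i" if "i < card I" for i
    using that card_pick by blast
  have "(\<Sum>j<d. zero_extend d I w $ j * x j) = (\<Sum>j\<in>I. w $ (card {a\<in>I. a < j}) * x j)"
    using I by (intro sum.mono_neutral_cong_right) (auto simp: zero_extend_def)
  also have "\<dots> = (\<Sum>i<card I. w $ i * x (pick I i))"
    using sum.reindex_bij_betw[OF bij_betw_pick[OF fin], of "\<lambda>j. w $ (card {a\<in>I. a < j}) * x j"]
    by (simp add: idx)
  finally show ?thesis .
qed

context
  fixes d :: nat and \<Sigma> :: "real mat" and I :: "nat set"
  assumes spd: "sym_pos_def d \<Sigma>" and I: "I \<subseteq> {..<d}"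
begin

lemma submatrix_principal:
  "submatrix \<Sigma> I I \<in> carrier_mat (card I) (card I)"
  "i < card I \<Longrightarrow> j < card I \<Longrightarrow> submatrix \<Sigma> I I $$ (i, j) = \<Sigma> $$ (pick I i, pick I j)"
  "i < card I \<Longrightarrow> pick I i \<in> I" "i < card I \<Longrightarrow> pick I i < d"
proof -
  have "{i. i < d \<and> i \<in> I} = I" using I by auto
  then show "submatrix \<Sigma> I I \<in> carrier_mat (card I) (card I)"
    "i < card I \<Longrightarrow> j < card I \<Longrightarrow> submatrix \<Sigma> I I $$ (i, j) = \<Sigma> $$ (pick I i, pick I j)"
    using sym_pos_defD(1)[OF spd] by (auto simp: submatrix_def)
  show "i < card I \<Longrightarrow> pick I i \<in> I" by (rule pick_in_set_le)
  then show "i < card I \<Longrightarrow> pick I i < d" using I by auto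
qed

lemma mult_zero_extend:
  assumes w: "w \<in> carrier_vec (card I)" and i: "i < card I"
  shows "(\<Sigma> *\<^sub>v zero_extend d I w) $ pick I i = (submatrix \<Sigma> I I *\<^sub>v w) $ i"
proof -
  have "(\<Sigma> *\<^sub>v zero_extend d I w) $ pick I i = (\<Sum>j<d. zero_extend d I w $ j * \<Sigma> $$ (pick I i, j))"
    using sym_pos_defD(1)[OF spd] submatrix_principal(4)[OF i]
    by (auto simp: scalar_prod_def mult.commute atLeast0LessThan zero_extend_def intro!: sum.cong)
  also have "\<dots> = (submatrix \<Sigma> I I *\<^sub>v w) $ i"
    unfolding sum_zero_extend[OF I] using submatrix_principal(1,2) i w
    by (auto simp: scalar_prod_def mult.commute atLeast0LessThan intro!: sum.cong)
  finally show ?thesis .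
qed

lemma sym_pos_def_submatrix: "sym_pos_def (card I) (submatrix \<Sigma> I I)"
  unfolding sym_pos_def_def
proof (intro conjI ballI impI)
  note S = sym_pos_defD[OF spd] submatrix_principal
  show "submatrix \<Sigma> I I \<in> carrier_mat (card I) (card I)" by (rule submatrix_principal)
  have sym: "\<Sigma> $$ (i, j) = \<Sigma> $$ (j, i)" if "i < d" "j < d" for i j
    using S(1,2) that by (metis carrier_matD index_transpose_mat(1))
  show "transpose_mat (submatrix \<Sigma> I I) = submatrix \<Sigma> I I"
    using submatrix_principal by (intro eq_matI) (auto intro: sym)
  fix v :: "real vec" assume v: "v \<in> carrier_vec (card I)" "v \<noteq> 0\<^sub>v (card I)"
  let ?e = "zero_extend d I v"
  have "?e \<noteq> 0\<^sub>v d"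
  proof
    assume 0: "?e = 0\<^sub>v d"
    have "v $ i = 0" if "i < card I" for i
    proof -
      have "?e $ pick I i = v $ i"
        using submatrix_principal(3,4)[OF that] by (simp add: zero_extend_def card_pick that)
      then show ?thesis using 0 submatrix_principal(4)[OF that] by simp
    qed
    then show False using v by auto
  qed
  then have "0 < ?e \<bullet> (\<Sigma> *\<^sub>v ?e)" by (intro sym_pos_defD(3)[OF spd]) auto
  also have "?e \<bullet> (\<Sigma> *\<^sub>v ?e) = (\<Sum>j<d. ?e $ j * (\<Sigma> *\<^sub>v ?e) $ j)"
    using S(1) by (simp add: scalar_prod_def atLeast0LessThan)
  also have "\<dots> = v \<bullet> (submatrix \<Sigma> I I *\<^sub>v v)"
    unfolding sum_zero_extend[OF I] using mult_zero_extend[OF v(1)] submatrix_principal(1)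
    by (auto simp: scalar_prod_def[of v] atLeast0LessThan simp del: index_mult_mat_vec intro!: sum.cong)
  finally show "0 < v \<bullet> (submatrix \<Sigma> I I *\<^sub>v v)" .
qed

text \<open>
  The direction \<open>w\<close> is \<open>\<Sigma>\<^sub>I\<^sup>-\<^sup>1 u\<^sub>I\<close> extended by zero. It turns the discriminant score of a pattern,
  written with submatrices of varying size, into a linear form on \<open>\<real>\<^sup>d\<close> whose image under \<open>\<Sigma>\<close> is
  prescribed on \<open>I\<close>.
\<close>

lemma subvec_score_direction:
  fixes u :: "nat \<Rightarrow> real"
  shows "\<exists>w \<in> carrier_vec d. (\<forall>j<d. j \<notin> I \<longrightarrow> w $ j = 0) \<and> (\<forall>j\<in>I. (\<Sigma> *\<^sub>v w) $ j = u j) \<and>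
    (\<forall>y. subvec u I \<bullet> (inv_mat (submatrix \<Sigma> I I) *\<^sub>v subvec y I) = (\<Sum>j<d. w $ j * y j))"
proof (intro bexI conjI allI ballI impI)
  let ?S = "submatrix \<Sigma> I I" and ?u = "subvec u I"
  note S = sym_pos_defD[OF sym_pos_def_submatrix] and inv = inv_mat_spd[OF sym_pos_def_submatrix]
  define z where "z = inv_mat ?S *\<^sub>v ?u"
  have u: "?u \<in> carrier_vec (card I)" and z: "z \<in> carrier_vec (card I)"
    using inv by (auto simp: z_def subvec_def)
  have Sz: "?S *\<^sub>v z = ?u"
    unfolding z_def using assoc_mult_mat_vec[OF S(1) inv(1) u] inv(2) u by simp
  let ?w = "zero_extend d I z"
  show "?w \<in> carrier_vec d" by simp
  show "?w $ j = 0" if "j < d" "j \<notin> I" for j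
    using that by (simp add: zero_extend_def)
  show "(\<Sigma> *\<^sub>v ?w) $ j = u j" if "j \<in> I" for j
  proof -
    obtain i where i: "i < card I" "j = pick I i"
      using bij_betw_pick[of I] \<open>j \<in> I\<close> I by (metis bij_betw_iff_bijections finite_lessThan finite_subset lessThan_iff)
    then show ?thesis using mult_zero_extend[OF z, of i] by (simp add: Sz subvec_def)
  qed
  fix y
  let ?y = "subvec y I"
  have y: "?y \<in> carrier_vec (card I)" by (simp add: subvec_def)
  have "?u \<bullet> (inv_mat ?S *\<^sub>v ?y) = (inv_mat ?S *\<^sub>v ?y) \<bullet> (?S *\<^sub>v z)"
    unfolding Sz using inv u y by (intro comm_scalar_prod) auto
  also have "\<dots> = z \<bullet> (?S *\<^sub>v (inv_mat ?S *\<^sub>v ?y))"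
    using inv(1) y z by (intro scalar_prod_mult_mat_vec_swap[OF S(1,2)]) auto
  also have "?S *\<^sub>v (inv_mat ?S *\<^sub>v ?y) = ?y"
    using assoc_mult_mat_vec[OF S(1) inv(1) y] inv(2) y by simp
  also have "z \<bullet> ?y = (\<Sum>j<d. ?w $ j * y j)"
    unfolding sum_zero_extend[OF I] by (simp add: scalar_prod_def subvec_def atLeast0LessThan)
  finally show "?u \<bullet> (inv_mat ?S *\<^sub>v ?y) = (\<Sum>j<d. ?w $ j * y j)" .
qed

end

section \<open>Likelihood ratio regions and Gaussian tilting\<close>

text \<open>
  The Neyman--Pearson argument: \<open>A\<close> and \<open>H\<close> differ by \<open>A - H\<close>, where \<open>f \<le> g\<close>, and \<open>H - A\<close>, where \<open>g \<le> f\<close>.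
\<close>

lemma density_region_optimal:
  assumes [measurable]: "f \<in> borel_measurable M" "g \<in> borel_measurable M" "A \<in> sets M" "H \<in> sets M"
    and fin: "finite_measure (density M f)" "finite_measure (density M g)"
    and H: "\<And>x. x \<in> H \<Longrightarrow> g x \<le> f x" and notH: "\<And>x. x \<in> space M - H \<Longrightarrow> f x \<le> g x"
  shows "measure (density M f) A - measure (density M g) A
    \<le> measure (density M f) H - measure (density M g) H"
proof -
  interpret F: finite_measure "density M f" by fact
  interpret G: finite_measure "density M g" by fact
  have le: "emeasure (density M u) S \<le> emeasure (density M v) S"
    if [measurable]: "u \<in> borel_measurable M" "v \<in> borel_measurable M" "S \<in> sets M"
      and "\<And>x. x \<in> S \<Longrightarrow> u x \<le> v x" for u v S
    unfolding emeasure_density[OF that(1,3)] emeasure_density[OF that(2,3)]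
    by (intro nn_integral_mono) (auto simp: that(4) split: split_indicator)
  have "emeasure (density M f) (A - H) \<le> emeasure (density M g) (A - H)"
    using notH sets.sets_into_space[OF assms(3)] by (intro le) auto
  then have 1: "measure (density M f) (A - H) \<le> measure (density M g) (A - H)"
    by (simp add: F.emeasure_eq_measure G.emeasure_eq_measure)
  have "emeasure (density M g) (H - A) \<le> emeasure (density M f) (H - A)"
    using H by (intro le) auto
  then have 2: "measure (density M g) (H - A) \<le> measure (density M f) (H - A)"
    by (simp add: F.emeasure_eq_measure G.emeasure_eq_measure)
  have split: "measure (density M f) A - measure (density M f) H
      = measure (density M f) (A - H) - measure (density M f) (H - A)"
    "measure (density M g) A - measure (density M g) H
      = measure (density M g) (A - H) - measure (density M g) (H - A)"
    using F.finite_measure_Diff'[of A H] F.finite_measure_Diff'[of H A]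
      G.finite_measure_Diff'[of A H] G.finite_measure_Diff'[of H A]
    by (simp_all add: Int_commute)
  with 1 2 show ?thesis by linarith
qed

text \<open>
  The centred normal law with variance \<open>s\<^sup>2\<close> is the only law on the line whose exponential tilt by any
  \<open>t\<close> is its translate by \<open>t s\<^sup>2\<close>. The assumption says that \<open>\<rho>\<close>, divided by the normal density, is translation invariant, and the
  computation below is the usual proof that Lebesgue measure is the only invariant measure up to
  a factor: integrate \<open>h(l) N(y)\<close> over \<open>\<rho>(dl) dy\<close>, shift \<open>y\<close> by \<open>l\<close>, use the invariance of \<open>\<rho>\<close> in \<open>l\<close>,
  and shift back.
\<close>

lemma normal_tilt_characterization:
  assumes "prob_space \<rho>" and sets: "sets \<rho> = sets borel" and s: "0 < (s :: real)"
    and tilt: "\<And>t h. h \<in> borel_measurable borel \<Longrightarrow>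
      (\<integral>\<^sup>+l. h l * ennreal (exp (t * l - t\<^sup>2 * s\<^sup>2 / 2)) \<partial>\<rho>) = (\<integral>\<^sup>+l. h (l + t * s\<^sup>2) \<partial>\<rho>)"
  shows "\<rho> = density lborel (normal_density 0 s)"
proof (rule measure_eqI)
  interpret prob_space \<rho> by fact
  interpret pair_sigma_finite \<rho> lborel ..
  note [measurable_cong] = sets
  let ?N = "\<lambda>x. ennreal (normal_density 0 s x)"
  have N1: "(\<integral>\<^sup>+y. ?N y \<partial>lborel) = 1"
    using prob_space.emeasure_space_1[OF prob_space_normal_density[OF s, of 0]] by (simp add: emeasure_density)
  show "sets \<rho> = sets (density lborel (normal_density 0 s))" using sets by simp
  fix A assume "A \<in> sets \<rho>"
  then have [measurable]: "A \<in> sets borel" using sets by simp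
  let ?h = "indicator A :: real \<Rightarrow> ennreal"
  have "emeasure \<rho> A = (\<integral>\<^sup>+l. ?h l \<partial>\<rho>)"
    by simp
  also have "\<dots> = (\<integral>\<^sup>+l. \<integral>\<^sup>+y. ?h l * ?N y \<partial>lborel \<partial>\<rho>)"
    by (simp add: nn_integral_cmult N1)
  also have "\<dots> = (\<integral>\<^sup>+l. \<integral>\<^sup>+y. ?h l * ?N (l + y) \<partial>lborel \<partial>\<rho>)"
  proof (rule nn_integral_cong)
    fix l
    show "(\<integral>\<^sup>+y. ?h l * ?N y \<partial>lborel) = (\<integral>\<^sup>+y. ?h l * ?N (l + y) \<partial>lborel)"
      using nn_integral_real_affine[of "\<lambda>y. ?h l * ?N y" 1 l] by simp
  qed
  also have "\<dots> = (\<integral>\<^sup>+y. \<integral>\<^sup>+l. ?h l * ?N (l + y) \<partial>\<rho> \<partial>lborel)"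
    by (rule Fubini'[symmetric]) measurable
  also have "\<dots> = (\<integral>\<^sup>+y. \<integral>\<^sup>+l. ?h (l - y) * ?N (l - y) \<partial>\<rho> \<partial>lborel)"
  proof (rule nn_integral_cong)
    fix y :: real
    \<comment> \<open>the tilt whose translation is by \<open>- y\<close>\<close>
    let ?t = "- y / s\<^sup>2"
    let ?g = "\<lambda>l. ?h l * ?N (l + y) * ennreal (exp (- (?t * l - ?t\<^sup>2 * s\<^sup>2 / 2)))"
    have "(\<integral>\<^sup>+l. ?h l * ?N (l + y) \<partial>\<rho>) = (\<integral>\<^sup>+l. ?g l * ennreal (exp (?t * l - ?t\<^sup>2 * s\<^sup>2 / 2)) \<partial>\<rho>)"
      by (simp add: mult.assoc ennreal_mult'[symmetric] exp_add[symmetric])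
    also have "\<dots> = (\<integral>\<^sup>+l. ?g (l + ?t * s\<^sup>2) \<partial>\<rho>)"
      by (rule tilt) measurable
    also have "\<dots> = (\<integral>\<^sup>+l. ?h (l - y) * ?N (l - y) \<partial>\<rho>)"
    proof (rule nn_integral_cong)
      fix l
      have ts: "l + ?t * s\<^sup>2 = l - y" using s by simp
      have "- (l\<^sup>2) / (2 * s\<^sup>2) + - (?t * (l - y) - ?t\<^sup>2 * s\<^sup>2 / 2) = - ((l - y)\<^sup>2) / (2 * s\<^sup>2)"
        using s by (simp add: field_simps power2_eq_square)
      then have "normal_density 0 s l * exp (- (?t * (l - y) - ?t\<^sup>2 * s\<^sup>2 / 2)) = normal_density 0 s (l - y)"
        unfolding normal_density_def by (simp add: exp_add[symmetric])
      then have "?N l * ennreal (exp (- (?t * (l - y) - ?t\<^sup>2 * s\<^sup>2 / 2))) = ?N (l - y)"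
        by (simp add: ennreal_mult'[symmetric] normal_density_nonneg)
      then show "?g (l + ?t * s\<^sup>2) = ?h (l - y) * ?N (l - y)"
        unfolding ts by (simp add: mult.assoc)
    qed
    finally show "(\<integral>\<^sup>+l. ?h l * ?N (l + y) \<partial>\<rho>) = (\<integral>\<^sup>+l. ?h (l - y) * ?N (l - y) \<partial>\<rho>)" .
  qed
  also have "\<dots> = (\<integral>\<^sup>+l. \<integral>\<^sup>+y. ?h (l - y) * ?N (l - y) \<partial>lborel \<partial>\<rho>)"
    by (rule Fubini') measurable
  also have "\<dots> = (\<integral>\<^sup>+l. \<integral>\<^sup>+y. ?h y * ?N y \<partial>lborel \<partial>\<rho>)"
  proof (rule nn_integral_cong)
    fix l
    show "(\<integral>\<^sup>+y. ?h (l - y) * ?N (l - y) \<partial>lborel) = (\<integral>\<^sup>+y. ?h y * ?N y \<partial>lborel)"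
      using nn_integral_real_affine[of "\<lambda>y. ?h y * ?N y" "-1" l] by simp
  qed
  also have "\<dots> = emeasure (density lborel (normal_density 0 s)) A"
    by (simp add: emeasure_space_1 emeasure_density mult.commute)
  finally show "emeasure \<rho> A = emeasure (density lborel (normal_density 0 s)) A" .
qed

section \<open>Shifts of the multivariate normal law\<close>

definition mvn :: "nat \<Rightarrow> real vec \<Rightarrow> real mat \<Rightarrow> (nat \<Rightarrow> real) measure" where
  "mvn d \<mu> \<Sigma> = density (PiM {..<d} (\<lambda>_. lborel)) (\<lambda>x. ennreal (mvn_density d \<mu> \<Sigma> x))"

lemma sets_PiM_lborel: "sets (PiM {..<d :: nat} (\<lambda>_. lborel :: real measure)) = sets (covariate_space d)"
  by (intro sets_PiM_cong) auto

lemma space_PiM_lborel: "space (PiM {..<d :: nat} (\<lambda>_. lborel :: real measure)) = space (covariate_space d)"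
  by (simp add: space_PiM)

lemma sets_mvn [measurable_cong, simp]: "sets (mvn d \<mu> \<Sigma>) = sets (covariate_space d)"
  by (simp add: mvn_def sets_PiM_lborel)

lemma space_mvn [simp]: "space (mvn d \<mu> \<Sigma>) = space (covariate_space d)"
  by (simp add: mvn_def space_PiM_lborel)

lemma measurable_scalar_prod_vec [measurable]:
  "a \<in> carrier_vec d \<Longrightarrow> \<mu> \<in> carrier_vec d \<Longrightarrow>
    (\<lambda>x. a \<bullet> (vec d x - \<mu>)) \<in> borel_measurable (covariate_space d)"
proof -
  assume a: "a \<in> carrier_vec d" and \<mu>: "\<mu> \<in> carrier_vec d"
  have "(\<lambda>x. \<Sum>i<d. a $ i * (x i - \<mu> $ i)) \<in> borel_measurable (covariate_space d)"
    by measurable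
  also have "(\<lambda>x. \<Sum>i<d. a $ i * (x i - \<mu> $ i)) = (\<lambda>x. a \<bullet> (vec d x - \<mu>))"
    using a \<mu> by (auto simp: scalar_prod_def atLeast0LessThan)
  finally show ?thesis .
qed

lemma PiM_lborel_translate:
  fixes v :: "nat \<Rightarrow> real"
  assumes fin: "finite I"
  shows "distr (PiM I (\<lambda>_. lborel)) (PiM I (\<lambda>_. lborel)) (\<lambda>x. \<lambda>i\<in>I. v i + x i) = PiM I (\<lambda>_. lborel)"
proof -
  interpret product_sigma_finite "\<lambda>_::nat. lborel :: real measure" ..
  have meas: "(\<lambda>x. \<lambda>i\<in>I. v i + x i) \<in> measurable (PiM I (\<lambda>_. lborel)) (PiM I (\<lambda>_. lborel))"
    by (intro measurable_restrict) simp
  show ?thesis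
  proof (rule PiM_eqI[OF fin])
    fix A :: "nat \<Rightarrow> real set" assume A: "\<And>i. i \<in> I \<Longrightarrow> A i \<in> sets lborel"
    have pre: "(\<lambda>x. \<lambda>i\<in>I. v i + x i) -` Pi\<^sub>E I A \<inter> space (PiM I (\<lambda>_. lborel))
      = Pi\<^sub>E I (\<lambda>i. (+) (v i) -` A i)"
      by (auto simp: space_PiM PiE_def Pi_def)
    have vA: "(+) (v i) -` A i \<in> sets lborel" if "i \<in> I" for i
      using A[OF that] measurable_sets[of "(+) (v i)" lborel lborel "A i"] by simp
    have "emeasure (distr (PiM I (\<lambda>_. lborel)) (PiM I (\<lambda>_. lborel)) (\<lambda>x. \<lambda>i\<in>I. v i + x i)) (Pi\<^sub>E I A)
       = (\<Prod>i\<in>I. emeasure lborel ((+) (v i) -` A i))"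
      using A fin emeasure_PiM[OF fin vA]
      by (subst emeasure_distr[OF meas]) (auto simp: pre intro!: sets_PiM_I_finite)
    also have "\<dots> = (\<Prod>i\<in>I. emeasure lborel (A i))"
    proof (rule prod.cong)
      fix i assume i: "i \<in> I"
      have "emeasure (distr lborel borel ((+) (v i))) (A i) = emeasure lborel ((+) (v i) -` A i)"
        using A[OF i] by (subst emeasure_distr) auto
      then show "emeasure lborel ((+) (v i) -` A i) = emeasure lborel (A i)"
        by (simp add: lborel_distr_plus)
    qed simp
    finally show "emeasure (distr (PiM I (\<lambda>_. lborel)) (PiM I (\<lambda>_. lborel)) (\<lambda>x. \<lambda>i\<in>I. v i + x i)) (Pi\<^sub>E I A)
      = (\<Prod>i\<in>I. emeasure lborel (A i))" .
  qed simp
qed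

text \<open>
  Translation invariance spreads the normalisation from one mean to all of them, and the value of
  the normalising constant never enters.
\<close>

locale gaussian_family =
  fixes d :: nat and \<Sigma> :: "real mat"
  assumes dim: "1 \<le> d" and spd: "sym_pos_def d \<Sigma>"
    and normalized: "\<exists>\<mu>\<^sub>0\<in>carrier_vec d. prob_space (mvn d \<mu>\<^sub>0 \<Sigma>)"
begin

lemma measurable_mvn_density [measurable]:
  "\<mu> \<in> carrier_vec d \<Longrightarrow> mvn_density d \<mu> \<Sigma> \<in> borel_measurable (covariate_space d)"
proof -
  assume \<mu>: "\<mu> \<in> carrier_vec d"
  have "(vec d x - \<mu>) \<bullet> (inv_mat \<Sigma> *\<^sub>v (vec d x - \<mu>))
     = (\<Sum>i<d. \<Sum>j<d. (x i - \<mu> $ i) * inv_mat \<Sigma> $$ (i,j) * (x j - \<mu> $ j))" for x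
    using \<mu> by (subst scalar_prod_mat_sum[OF inv_mat_spd(1)[OF spd]]) auto
  then show ?thesis unfolding mvn_density_def by simp
qed

text \<open>
  Completing the square. The exponent is affine in \<open>x\<close> with slope \<open>a\<close>, so it involves only the
  coordinates on which \<open>a\<close> does not vanish.
\<close>

lemma mvn_density_shift:
  assumes \<mu>: "\<mu> \<in> carrier_vec d" and a: "a \<in> carrier_vec d"
  shows "mvn_density d (\<mu> + \<Sigma> *\<^sub>v a) \<Sigma> x
    = mvn_density d \<mu> \<Sigma> x * exp (a \<bullet> (vec d x - \<mu>) - (a \<bullet> (\<Sigma> *\<^sub>v a)) / 2)"
proof -
  note S = sym_pos_defD[OF spd] and inv = inv_mat_spd[OF spd]
  define y where "y = vec d x - \<mu>"
  have y: "y \<in> carrier_vec d" and Sa: "\<Sigma> *\<^sub>v a \<in> carrier_vec d"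
    using \<mu> S(1) a by (auto simp: y_def)
  have eq: "vec d x - (\<mu> + \<Sigma> *\<^sub>v a) = y - 1 \<cdot>\<^sub>v (\<Sigma> *\<^sub>v a)"
    using \<mu> S(1) a by (intro eq_vecI) (auto simp: y_def)
  have BS: "inv_mat \<Sigma> *\<^sub>v (\<Sigma> *\<^sub>v a) = a"
    using assoc_mult_mat_vec[OF inv(1) S(1) a] inv(3) a by simp
  have B: "inv_mat \<Sigma> *\<^sub>v (y - 1 \<cdot>\<^sub>v (\<Sigma> *\<^sub>v a)) = inv_mat \<Sigma> *\<^sub>v y - 1 \<cdot>\<^sub>v a"
    using mult_minus_distrib_mat_vec[OF inv(1) y Sa] BS by simp
  have By: "inv_mat \<Sigma> *\<^sub>v y \<in> carrier_vec d" using inv(1) y by auto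
  have "(\<Sigma> *\<^sub>v a) \<bullet> (inv_mat \<Sigma> *\<^sub>v y) = (inv_mat \<Sigma> *\<^sub>v y) \<bullet> (\<Sigma> *\<^sub>v a)"
    by (rule comm_scalar_prod[OF Sa By])
  also have "\<dots> = a \<bullet> (\<Sigma> *\<^sub>v (inv_mat \<Sigma> *\<^sub>v y))"
    by (rule scalar_prod_mult_mat_vec_swap[OF S(1,2) By a])
  also have "\<Sigma> *\<^sub>v (inv_mat \<Sigma> *\<^sub>v y) = y"
    using assoc_mult_mat_vec[OF S(1) inv(1) y] inv(2) y by simp
  finally have cross: "(\<Sigma> *\<^sub>v a) \<bullet> (inv_mat \<Sigma> *\<^sub>v y) = a \<bullet> y" .
  have "(y - 1 \<cdot>\<^sub>v (\<Sigma> *\<^sub>v a)) \<bullet> (inv_mat \<Sigma> *\<^sub>v y - 1 \<cdot>\<^sub>v a)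
    = y \<bullet> (inv_mat \<Sigma> *\<^sub>v y) - 2 * (a \<bullet> y) + a \<bullet> (\<Sigma> *\<^sub>v a)"
    using scalar_prod_diff_scaled[OF y Sa By a, of 1] cross comm_scalar_prod[OF y a] comm_scalar_prod[OF Sa a]
    by simp
  then have "- ((y - 1 \<cdot>\<^sub>v (\<Sigma> *\<^sub>v a)) \<bullet> (inv_mat \<Sigma> *\<^sub>v y - 1 \<cdot>\<^sub>v a)) / 2
    = - (y \<bullet> (inv_mat \<Sigma> *\<^sub>v y)) / 2 + (a \<bullet> y - (a \<bullet> (\<Sigma> *\<^sub>v a)) / 2)"
    by (simp add: field_simps)
  then have "exp (- ((y - 1 \<cdot>\<^sub>v (\<Sigma> *\<^sub>v a)) \<bullet> (inv_mat \<Sigma> *\<^sub>v y - 1 \<cdot>\<^sub>v a)) / 2)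
    = exp (- (y \<bullet> (inv_mat \<Sigma> *\<^sub>v y)) / 2) * exp (a \<bullet> y - (a \<bullet> (\<Sigma> *\<^sub>v a)) / 2)"
    by (simp only: exp_add)
  then show ?thesis
    unfolding mvn_density_def eq B y_def[symmetric] by (simp only: times_divide_eq_left)
qed

lemma nn_integral_mvn_translate:
  assumes \<mu>: "\<mu> \<in> carrier_vec d" and [measurable]: "f \<in> borel_measurable (covariate_space d)"
  shows "(\<integral>\<^sup>+x. f x \<partial>mvn d (\<mu> + vec d v) \<Sigma>) = (\<integral>\<^sup>+x. f (\<lambda>i\<in>{..<d}. v i + x i) \<partial>mvn d \<mu> \<Sigma>)"
proof -
  let ?P = "PiM {..<d} (\<lambda>_. lborel :: real measure)" and ?T = "\<lambda>x. \<lambda>i\<in>{..<d}. v i + x i"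
  note [measurable_cong] = sets_PiM_lborel
  have T [measurable]: "?T \<in> measurable (covariate_space d) (covariate_space d)"
    by (intro measurable_restrict) measurable
  have T': "?T \<in> measurable ?P ?P"
    by (intro measurable_restrict) simp
  have \<mu>v [measurable]: "mvn_density d (\<mu> + vec d v) \<Sigma> \<in> borel_measurable (covariate_space d)"
    using \<mu> by (intro measurable_mvn_density) auto
  note [measurable] = measurable_mvn_density[OF \<mu>]
  have dens: "mvn_density d (\<mu> + vec d v) \<Sigma> (?T x) = mvn_density d \<mu> \<Sigma> x" for x
  proof -
    have "vec d (?T x) - (\<mu> + vec d v) = vec d x - \<mu>"
      using \<mu> by (intro eq_vecI) auto
    then show ?thesis unfolding mvn_density_def by simp
  qed
  have "(\<integral>\<^sup>+x. f x \<partial>mvn d (\<mu> + vec d v) \<Sigma>) = (\<integral>\<^sup>+x. ennreal (mvn_density d (\<mu> + vec d v) \<Sigma> x) * f x \<partial>?P)"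
    unfolding mvn_def by (rule nn_integral_density) measurable
  also have "\<dots> = (\<integral>\<^sup>+x. ennreal (mvn_density d (\<mu> + vec d v) \<Sigma> x) * f x \<partial>distr ?P ?P ?T)"
    by (simp add: PiM_lborel_translate)
  also have "\<dots> = (\<integral>\<^sup>+x. ennreal (mvn_density d (\<mu> + vec d v) \<Sigma> (?T x)) * f (?T x) \<partial>?P)"
    by (rule nn_integral_distr[OF T']) measurable
  also have "\<dots> = (\<integral>\<^sup>+x. f (?T x) \<partial>mvn d \<mu> \<Sigma>)"
    unfolding dens mvn_def by (rule nn_integral_density[symmetric]) measurable
  finally show ?thesis .
qed

lemma prob_space_mvn:
  assumes \<mu>: "\<mu> \<in> carrier_vec d"
  shows "prob_space (mvn d \<mu> \<Sigma>)"
proof -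
  obtain \<mu>\<^sub>0 where \<mu>0: "\<mu>\<^sub>0 \<in> carrier_vec d" and P: "prob_space (mvn d \<mu>\<^sub>0 \<Sigma>)"
    using normalized by blast
  have "\<mu> = \<mu>\<^sub>0 + vec d (\<lambda>i. \<mu> $ i - \<mu>\<^sub>0 $ i)"
    using \<mu> \<mu>0 by (intro eq_vecI) auto
  then have "(\<integral>\<^sup>+x. 1 \<partial>mvn d \<mu> \<Sigma>) = (\<integral>\<^sup>+x. 1 \<partial>mvn d \<mu>\<^sub>0 \<Sigma>)"
    using nn_integral_mvn_translate[OF \<mu>0, of "\<lambda>_. 1" "\<lambda>i. \<mu> $ i - \<mu>\<^sub>0 $ i"] by simp
  also have "\<dots> = 1" using prob_space.emeasure_space_1[OF P] by simp
  finally show ?thesis by (intro prob_spaceI) simp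
qed

text \<open>
  Tilting by \<open>exp (t L)\<close>, where \<open>L\<close> is the functional, moves the mean by \<open>t \<Sigma> a\<close>, which translates \<open>L\<close> by \<open>t a\<^sup>T \<Sigma> a\<close>; by the characterization
  above the law of \<open>L\<close> is normal.
\<close>

lemma distr_linear_functional:
  assumes \<mu>: "\<mu> \<in> carrier_vec d" and a: "a \<in> carrier_vec d" "a \<noteq> 0\<^sub>v d"
  shows "distr (mvn d \<mu> \<Sigma>) borel (\<lambda>x. a \<bullet> (vec d x - \<mu>))
    = density lborel (normal_density 0 (sqrt (a \<bullet> (\<Sigma> *\<^sub>v a))))"
proof (rule normal_tilt_characterization)
  note S = sym_pos_defD[OF spd]
  let ?L = "\<lambda>x. a \<bullet> (vec d x - \<mu>)" and ?s = "sqrt (a \<bullet> (\<Sigma> *\<^sub>v a))"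
  note [measurable] = measurable_scalar_prod_vec[OF a(1) \<mu>] measurable_mvn_density[OF \<mu>]
  note [measurable_cong] = sets_PiM_lborel
  have pos: "0 < a \<bullet> (\<Sigma> *\<^sub>v a)" by (rule S(3)[OF a])
  show "prob_space (distr (mvn d \<mu> \<Sigma>) borel ?L)"
    by (rule prob_space.prob_space_distr[OF prob_space_mvn[OF \<mu>]]) simp
  show "0 < ?s" using pos by simp
  fix t :: real and h :: "real \<Rightarrow> ennreal" assume [measurable]: "h \<in> borel_measurable borel"
  have Sta: "\<Sigma> *\<^sub>v (t \<cdot>\<^sub>v a) = t \<cdot>\<^sub>v (\<Sigma> *\<^sub>v a)" using S(1) a by (simp add: mult_mat_vec)
  have Sa: "\<Sigma> *\<^sub>v a \<in> carrier_vec d" using S(1) a by auto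
  let ?v = "\<lambda>i. (t \<cdot>\<^sub>v (\<Sigma> *\<^sub>v a)) $ i"
  have v: "vec d ?v = \<Sigma> *\<^sub>v (t \<cdot>\<^sub>v a)" unfolding Sta using Sa S(1) by (intro eq_vecI) auto
  have \<mu>v [measurable]: "mvn_density d (\<mu> + vec d ?v) \<Sigma> \<in> borel_measurable (covariate_space d)"
    using \<mu> by (intro measurable_mvn_density) auto
  have dens: "mvn_density d (\<mu> + vec d ?v) \<Sigma> x = mvn_density d \<mu> \<Sigma> x * exp (t * ?L x - t\<^sup>2 * ?s\<^sup>2 / 2)" for x
  proof -
    have "(t \<cdot>\<^sub>v a) \<bullet> (vec d x - \<mu>) = t * ?L x" using a \<mu> by simp
    moreover have "(t \<cdot>\<^sub>v a) \<bullet> (\<Sigma> *\<^sub>v (t \<cdot>\<^sub>v a)) = t\<^sup>2 * ?s\<^sup>2"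
      unfolding Sta using pos a S(1) by (simp add: power2_eq_square)
    ultimately show ?thesis unfolding v using mvn_density_shift[OF \<mu>, of "t \<cdot>\<^sub>v a" x] a by simp
  qed
  have L: "?L (\<lambda>i\<in>{..<d}. ?v i + x i) = ?L x + t * ?s\<^sup>2" for x
  proof -
    have eq: "vec d (\<lambda>i\<in>{..<d}. ?v i + x i) - \<mu> = (vec d x - \<mu>) + t \<cdot>\<^sub>v (\<Sigma> *\<^sub>v a)"
      using \<mu> Sa S(1) by (intro eq_vecI) auto
    have "a \<bullet> ((vec d x - \<mu>) + t \<cdot>\<^sub>v (\<Sigma> *\<^sub>v a)) = ?L x + a \<bullet> (t \<cdot>\<^sub>v (\<Sigma> *\<^sub>v a))"
      using a \<mu> Sa by (intro scalar_prod_add_distrib) auto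
    then show ?thesis unfolding eq using pos a Sa by simp
  qed
  have "(\<integral>\<^sup>+l. h l * ennreal (exp (t * l - t\<^sup>2 * ?s\<^sup>2 / 2)) \<partial>distr (mvn d \<mu> \<Sigma>) borel ?L)
    = (\<integral>\<^sup>+x. h (?L x) * ennreal (exp (t * ?L x - t\<^sup>2 * ?s\<^sup>2 / 2)) \<partial>mvn d \<mu> \<Sigma>)"
    by (rule nn_integral_distr) measurable
  also have "\<dots> = (\<integral>\<^sup>+x. ennreal (mvn_density d \<mu> \<Sigma> x) * (h (?L x) * ennreal (exp (t * ?L x - t\<^sup>2 * ?s\<^sup>2 / 2)))
      \<partial>PiM {..<d} (\<lambda>_. lborel))"
    unfolding mvn_def by (rule nn_integral_density) measurable
  also have "\<dots> = (\<integral>\<^sup>+x. ennreal (mvn_density d (\<mu> + vec d ?v) \<Sigma> x) * h (?L x) \<partial>PiM {..<d} (\<lambda>_. lborel))"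
    unfolding dens by (intro nn_integral_cong) (simp add: ennreal_mult'' mult_ac)
  also have "\<dots> = (\<integral>\<^sup>+x. h (?L x) \<partial>mvn d (\<mu> + vec d ?v) \<Sigma>)"
    unfolding mvn_def by (rule nn_integral_density[symmetric]) measurable
  also have "\<dots> = (\<integral>\<^sup>+x. h (?L (\<lambda>i\<in>{..<d}. ?v i + x i)) \<partial>mvn d \<mu> \<Sigma>)"
    by (rule nn_integral_mvn_translate[OF \<mu>]) measurable
  also have "\<dots> = (\<integral>\<^sup>+l. h (l + t * ?s\<^sup>2) \<partial>distr (mvn d \<mu> \<Sigma>) borel ?L)"
    unfolding L by (rule nn_integral_distr[symmetric]) measurable
  finally show "(\<integral>\<^sup>+l. h l * ennreal (exp (t * l - t\<^sup>2 * ?s\<^sup>2 / 2)) \<partial>distr (mvn d \<mu> \<Sigma>) borel ?L)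
    = (\<integral>\<^sup>+l. h (l + t * ?s\<^sup>2) \<partial>distr (mvn d \<mu> \<Sigma>) borel ?L)" .
qed simp

text \<open>
  The region where \<open>N(\<mu>, \<Sigma>)\<close> is more likely than \<open>N(\<mu> + \<Sigma> z, \<Sigma>)\<close> is a half-space. With \<open>z\<close> the
  Mahalanobis direction between two means this computes a total variation distance; with \<open>z\<close> the
  discriminant direction it says that the discriminant rule is the Bayes rule.
\<close>

lemma mvn_tilt_region_optimal:
  assumes \<mu>: "\<mu> \<in> carrier_vec d" and z: "z \<in> carrier_vec d" and A [measurable]: "A \<in> sets (covariate_space d)"
  defines "\<nu> \<equiv> \<mu> + \<Sigma> *\<^sub>v z"
  defines "H \<equiv> {x \<in> space (covariate_space d). z \<bullet> (vec d x - \<mu>) - (z \<bullet> (\<Sigma> *\<^sub>v z)) / 2 < 0}"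
  shows "measure (mvn d \<mu> \<Sigma>) A - measure (mvn d \<nu> \<Sigma>) A \<le> measure (mvn d \<mu> \<Sigma>) H - measure (mvn d \<nu> \<Sigma>) H"
proof -
  let ?s = "\<lambda>x. z \<bullet> (vec d x - \<mu>) - (z \<bullet> (\<Sigma> *\<^sub>v z)) / 2"
  have \<nu>: "\<nu> \<in> carrier_vec d" using \<mu> z sym_pos_defD(1)[OF spd] by (auto simp: \<nu>_def)
  note [measurable] = measurable_scalar_prod_vec[OF z \<mu>] measurable_mvn_density[OF \<mu>] measurable_mvn_density[OF \<nu>]
  note [measurable_cong] = sets_PiM_lborel
  interpret P: prob_space "mvn d \<mu> \<Sigma>" by (rule prob_space_mvn[OF \<mu>])
  interpret R: prob_space "mvn d \<nu> \<Sigma>" by (rule prob_space_mvn[OF \<nu>])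
  have [measurable]: "H \<in> sets (covariate_space d)" unfolding H_def by measurable
  have ratio: "ennreal (mvn_density d \<nu> \<Sigma> x) = ennreal (mvn_density d \<mu> \<Sigma> x) * ennreal (exp (?s x))" for x
    unfolding \<nu>_def mvn_density_shift[OF \<mu> z] by (simp add: ennreal_mult'')
  have below: "ennreal (mvn_density d \<nu> \<Sigma> x) \<le> ennreal (mvn_density d \<mu> \<Sigma> x)" if "?s x < 0" for x
  proof -
    have "ennreal (mvn_density d \<mu> \<Sigma> x) * ennreal (exp (?s x)) \<le> ennreal (mvn_density d \<mu> \<Sigma> x) * 1"
      using that by (intro mult_left_mono) auto
    then show ?thesis unfolding ratio by simp
  qed
  have above: "ennreal (mvn_density d \<mu> \<Sigma> x) \<le> ennreal (mvn_density d \<nu> \<Sigma> x)" if "\<not> ?s x < 0" for x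
  proof -
    have "1 \<le> exp (?s x)" using that by simp
    then have "ennreal (mvn_density d \<mu> \<Sigma> x) * 1 \<le> ennreal (mvn_density d \<mu> \<Sigma> x) * ennreal (exp (?s x))"
      by (intro mult_left_mono) auto
    then show ?thesis unfolding ratio by simp
  qed
  show ?thesis
    unfolding mvn_def
  proof (rule density_region_optimal)
    show "finite_measure (density (PiM {..<d} (\<lambda>_. lborel)) (\<lambda>x. ennreal (mvn_density d \<mu> \<Sigma> x)))"
      using P.finite_measure_axioms by (simp add: mvn_def)
    show "finite_measure (density (PiM {..<d} (\<lambda>_. lborel)) (\<lambda>x. ennreal (mvn_density d \<nu> \<Sigma> x)))"
      using R.finite_measure_axioms by (simp add: mvn_def)
  qed (use below above in \<open>auto simp: H_def sets_PiM_lborel space_PiM_lborel\<close>, measurable)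
qed

text \<open>
  The difference is the mass of an interval of length \<open>s\<^sup>2\<close>, on which the density is at most
  \<open>1 / (s * sqrt (2 * pi))\<close>.
\<close>

lemma normal_interval_mass_le:
  assumes s: "0 < (s :: real)"
  shows "measure (density lborel (normal_density 0 s)) {..<u} - measure (density lborel (normal_density 0 s)) {..<u - s\<^sup>2}
    \<le> s / sqrt (2 * pi)"
proof -
  let ?M = "density lborel (normal_density 0 s)"
  interpret prob_space ?M by (rule prob_space_normal_density[OF s])
  have "measure ?M {..<u} - measure ?M {..<u - s\<^sup>2} = measure ?M ({..<u} - {..<u - s\<^sup>2})"
    by (rule finite_measure_Diff[symmetric]) auto
  also have "{..<u} - {..<u - s\<^sup>2} = {u - s\<^sup>2..<u}" by auto
  also have "ennreal (measure ?M {u - s\<^sup>2..<u}) = emeasure ?M {u - s\<^sup>2..<u}"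
    by (simp add: emeasure_eq_measure)
  also have "\<dots> \<le> (\<integral>\<^sup>+x. ennreal (1 / sqrt (2 * pi * s\<^sup>2)) * indicator {u - s\<^sup>2..<u} x \<partial>lborel)"
    unfolding emeasure_density[of "\<lambda>x. ennreal (normal_density 0 s x)" lborel "{u - s\<^sup>2..<u}", simplified]
    by (intro nn_integral_mono mult_right_mono ennreal_leI) (auto simp: normal_density_def intro!: divide_right_mono)
  also have "\<dots> = ennreal (1 / sqrt (2 * pi * s\<^sup>2)) * ennreal (s\<^sup>2)"
    by (simp add: nn_integral_cmult)
  also have "\<dots> = ennreal (s / sqrt (2 * pi))"
    using s by (simp add: ennreal_mult'[symmetric] real_sqrt_mult power2_eq_square)
  finally show ?thesis using s by simp
qed

text \<open>
  The worst event is a half-space orthogonal to \<open>z\<close>. Under both laws the functional \<open>z\<^sup>T x\<close> is normal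
  with variance \<open>z\<^sup>T \<Sigma> z\<close>, and its means differ by the same amount.
\<close>

lemma mvn_measure_shift_diff_le:
  assumes \<mu>: "\<mu> \<in> carrier_vec d" and z: "z \<in> carrier_vec d"
    and [measurable]: "A \<in> sets (covariate_space d)"
  shows "measure (mvn d \<mu> \<Sigma>) A - measure (mvn d (\<mu> + \<Sigma> *\<^sub>v z) \<Sigma>) A \<le> sqrt (z \<bullet> (\<Sigma> *\<^sub>v z)) / sqrt (2 * pi)"
proof (cases "z = 0\<^sub>v d")
  case True
  have "\<Sigma> *\<^sub>v 0\<^sub>v d = 0\<^sub>v d" using sym_pos_defD(1)[OF spd] by (intro eq_vecI) auto
  then show ?thesis using True \<mu> by simp
next
  case False
  let ?\<nu> = "\<mu> + \<Sigma> *\<^sub>v z" and ?s = "sqrt (z \<bullet> (\<Sigma> *\<^sub>v z))"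
  have Sz: "\<Sigma> *\<^sub>v z \<in> carrier_vec d" using sym_pos_defD(1)[OF spd] z by auto
  then have \<nu>: "?\<nu> \<in> carrier_vec d" using \<mu> by auto
  have pos: "0 < z \<bullet> (\<Sigma> *\<^sub>v z)" by (rule sym_pos_defD(3)[OF spd z False])
  let ?L = "\<lambda>x. z \<bullet> (vec d x - \<mu>)" and ?L' = "\<lambda>x. z \<bullet> (vec d x - ?\<nu>)"
  note [measurable] = measurable_scalar_prod_vec[OF z \<mu>] measurable_scalar_prod_vec[OF z \<nu>]
  have L': "?L' x = ?L x - ?s\<^sup>2" for x
  proof -
    have "vec d x - ?\<nu> = (vec d x - \<mu>) - \<Sigma> *\<^sub>v z"
      using \<mu> Sz sym_pos_defD(1)[OF spd] by (intro eq_vecI) auto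
    then show ?thesis
      using scalar_prod_minus_distrib[OF z _ Sz, of "vec d x - \<mu>"] \<mu> pos by simp
  qed
  let ?H = "{x \<in> space (covariate_space d). ?L x < ?s\<^sup>2 / 2}"
  have "?H = {x \<in> space (covariate_space d). ?L x - (z \<bullet> (\<Sigma> *\<^sub>v z)) / 2 < 0}"
    using pos by simp
  then have "measure (mvn d \<mu> \<Sigma>) A - measure (mvn d ?\<nu> \<Sigma>) A \<le> measure (mvn d \<mu> \<Sigma>) ?H - measure (mvn d ?\<nu> \<Sigma>) ?H"
    using mvn_tilt_region_optimal[OF \<mu> z, of A] by simp
  also have "measure (mvn d \<mu> \<Sigma>) ?H = measure (distr (mvn d \<mu> \<Sigma>) borel ?L) {..<?s\<^sup>2 / 2}"
    by (subst measure_distr) (auto intro!: arg_cong[where f = "measure _"])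
  also have "\<dots> = measure (density lborel (normal_density 0 ?s)) {..<?s\<^sup>2 / 2}"
    by (simp add: distr_linear_functional[OF \<mu> z False])
  also have "measure (mvn d ?\<nu> \<Sigma>) ?H = measure (distr (mvn d ?\<nu> \<Sigma>) borel ?L') {..<?s\<^sup>2 / 2 - ?s\<^sup>2}"
    by (subst measure_distr) (auto simp: L' simp del: real_sqrt_pow2_iff intro!: arg_cong[where f = "measure _"])
  also have "\<dots> = measure (density lborel (normal_density 0 ?s)) {..<?s\<^sup>2 / 2 - ?s\<^sup>2}"
    by (simp add: distr_linear_functional[OF \<nu> z False])
  also have "measure (density lborel (normal_density 0 ?s)) {..<?s\<^sup>2 / 2}
      - measure (density lborel (normal_density 0 ?s)) {..<?s\<^sup>2 / 2 - ?s\<^sup>2} \<le> ?s / sqrt (2 * pi)"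
    using pos by (intro normal_interval_mass_le) simp
  finally show ?thesis .
qed

lemma mvn_measure_diff_le:
  assumes \<mu>: "\<mu> \<in> carrier_vec d" and \<nu>: "\<nu> \<in> carrier_vec d" and A: "A \<in> sets (covariate_space d)"
  shows "measure (mvn d \<mu> \<Sigma>) A - measure (mvn d \<nu> \<Sigma>) A
    \<le> sqrt ((\<Sum>j<d. (\<nu> $ j - \<mu> $ j)\<^sup>2) / lambda_min \<Sigma>) / sqrt (2 * pi)"
proof -
  note S = sym_pos_defD[OF spd] and inv = inv_mat_spd[OF spd]
  define z where "z = inv_mat \<Sigma> *\<^sub>v (\<nu> - \<mu>)"
  have diff: "\<nu> - \<mu> \<in> carrier_vec d" and z: "z \<in> carrier_vec d" using \<mu> \<nu> inv by (auto simp: z_def)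
  have Sz: "\<Sigma> *\<^sub>v z = \<nu> - \<mu>"
    unfolding z_def using assoc_mult_mat_vec[OF S(1) inv(1) diff] inv(2) diff by simp
  have "\<mu> + \<Sigma> *\<^sub>v z = \<nu>" unfolding Sz using \<mu> \<nu> by (intro eq_vecI) auto
  then have "measure (mvn d \<mu> \<Sigma>) A - measure (mvn d \<nu> \<Sigma>) A \<le> sqrt (z \<bullet> (\<Sigma> *\<^sub>v z)) / sqrt (2 * pi)"
    using mvn_measure_shift_diff_le[OF \<mu> z A] by simp
  also have "\<dots> \<le> sqrt (((\<Sigma> *\<^sub>v z) \<bullet> (\<Sigma> *\<^sub>v z)) / lambda_min \<Sigma>) / sqrt (2 * pi)"
    by (intro divide_right_mono real_sqrt_le_mono inverse_quadratic_form_le[OF spd dim z]) auto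
  also have "(\<Sigma> *\<^sub>v z) \<bullet> (\<Sigma> *\<^sub>v z) = (\<Sum>j<d. (\<nu> $ j - \<mu> $ j)\<^sup>2)"
    unfolding Sz using \<mu> \<nu> by (auto simp: scalar_prod_def power2_eq_square atLeast0LessThan)
  finally show ?thesis .
qed

text \<open>
  The two laws are translates of each other along a vector that vanishes on \<open>I\<close>, and the event is
  invariant under such translations.
\<close>

lemma mvn_cylinder_cong:
  assumes \<mu>: "\<mu> \<in> carrier_vec d" and \<nu>: "\<nu> \<in> carrier_vec d"
    and [measurable]: "A \<in> sets (covariate_space d)"
    and cyl: "\<And>x y. x \<in> space (covariate_space d) \<Longrightarrow> y \<in> space (covariate_space d) \<Longrightarrow>
      (\<And>j. j \<in> I \<Longrightarrow> x j = y j) \<Longrightarrow> x \<in> A \<Longrightarrow> y \<in> A"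
    and I: "I \<subseteq> {..<d}" and eq: "\<And>j. j \<in> I \<Longrightarrow> \<mu> $ j = \<nu> $ j"
  shows "measure (mvn d \<mu> \<Sigma>) A = measure (mvn d \<nu> \<Sigma>) A"
proof -
  let ?v = "\<lambda>j. \<nu> $ j - \<mu> $ j"
  have \<nu>': "\<nu> = \<mu> + vec d ?v" using \<mu> \<nu> by (intro eq_vecI) auto
  have "emeasure (mvn d \<nu> \<Sigma>) A = (\<integral>\<^sup>+x. indicator A x \<partial>mvn d (\<mu> + vec d ?v) \<Sigma>)"
    by (simp add: \<nu>'[symmetric])
  also have "\<dots> = (\<integral>\<^sup>+x. indicator A (\<lambda>j\<in>{..<d}. ?v j + x j) \<partial>mvn d \<mu> \<Sigma>)"
    by (rule nn_integral_mvn_translate[OF \<mu>]) measurable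
  also have "\<dots> = (\<integral>\<^sup>+x. indicator A x \<partial>mvn d \<mu> \<Sigma>)"
  proof (rule nn_integral_cong)
    fix x assume x: "x \<in> space (mvn d \<mu> \<Sigma>)"
    let ?x = "\<lambda>j\<in>{..<d}. ?v j + x j"
    have x': "?x \<in> space (covariate_space d)" by (simp add: space_PiM)
    have xs: "x \<in> space (covariate_space d)" using x by simp
    have xeq: "x j = ?x j" "?x j = x j" if "j \<in> I" for j using that I eq by auto
    have "?x \<in> A \<longleftrightarrow> x \<in> A"
      using cyl[OF xs x' xeq(1)] cyl[OF x' xs xeq(2)] by (rule iffI[rotated])
    then show "indicator A ?x = (indicator A x :: ennreal)" by (simp add: indicator_def)
  qed
  also have "\<dots> = emeasure (mvn d \<mu> \<Sigma>) A" by simp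
  finally show ?thesis by (simp add: measure_def)
qed

section \<open>Excess risk of a plug-in rule on one pattern\<close>

text \<open>
  Here \<open>H\<close> and \<open>A\<close> are the regions where the plug-in rule and a competitor that sees only the
  coordinates in \<open>I\<close> predict \<open>-1\<close>, and the left-hand side is twice the difference of their balanced
  risks. The means are first moved to \<open>\<nu>p\<close> and \<open>\<nu>m\<close>, which agree with the estimates \<open>ap\<close> and \<open>am\<close> on
  \<open>I\<close> and with the true means elsewhere; this costs four total variation distances, two for each class.
  Then \<open>\<nu>p\<close> is replaced by \<open>\<nu>' = \<nu>m + \<Sigma> w\<close>, which has the same coordinates on \<open>I\<close>, so the
  probabilities of \<open>H\<close> and \<open>A\<close> do not change; but now the likelihood ratio of the two classes is
  exactly the exponential of the score that defines \<open>H\<close>, and \<open>H\<close> is optimal.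
\<close>

lemma plug_in_excess_le:
  fixes ap am :: "nat \<Rightarrow> real"
  assumes \<mu>: "\<mu>p \<in> carrier_vec d" "\<mu>m \<in> carrier_vec d" and I: "I \<subseteq> {..<d}"
    and w: "w \<in> carrier_vec d" "\<And>j. j < d \<Longrightarrow> j \<notin> I \<Longrightarrow> w $ j = 0"
    and Sw: "\<And>j. j \<in> I \<Longrightarrow> (\<Sigma> *\<^sub>v w) $ j = ap j - am j"
    and A [measurable]: "A \<in> sets (covariate_space d)"
    and cyl: "\<And>x y. x \<in> space (covariate_space d) \<Longrightarrow> y \<in> space (covariate_space d) \<Longrightarrow>
      (\<And>j. j \<in> I \<Longrightarrow> x j = y j) \<Longrightarrow> x \<in> A \<Longrightarrow> y \<in> A"
  defines "H \<equiv> {x \<in> space (covariate_space d). (\<Sum>j<d. w $ j * (x j - (ap j + am j) / 2)) < 0}"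
  shows "(measure (mvn d \<mu>p \<Sigma>) H - measure (mvn d \<mu>m \<Sigma>) H)
      - (measure (mvn d \<mu>p \<Sigma>) A - measure (mvn d \<mu>m \<Sigma>) A)
    \<le> 2 * (sqrt ((\<Sum>j\<in>I. (ap j - \<mu>p $ j)\<^sup>2) / lambda_min \<Sigma>)
         + sqrt ((\<Sum>j\<in>I. (am j - \<mu>m $ j)\<^sup>2) / lambda_min \<Sigma>)) / sqrt (2 * pi)"
proof -
  note S = sym_pos_defD[OF spd]
  define \<nu>p where "\<nu>p = vec d (\<lambda>j. if j \<in> I then ap j else \<mu>p $ j)"
  define \<nu>m where "\<nu>m = vec d (\<lambda>j. if j \<in> I then am j else \<mu>m $ j)"
  define \<nu>' where "\<nu>' = \<nu>m + \<Sigma> *\<^sub>v w"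
  have Swc: "\<Sigma> *\<^sub>v w \<in> carrier_vec d" using S(1) w by auto
  have \<nu>: "\<nu>p \<in> carrier_vec d" "\<nu>m \<in> carrier_vec d" "\<nu>' \<in> carrier_vec d"
    using Swc by (auto simp: \<nu>p_def \<nu>m_def \<nu>'_def)
  have H [measurable]: "H \<in> sets (covariate_space d)" unfolding H_def by measurable
  have score: "w \<bullet> (vec d x - \<nu>m) - (w \<bullet> (\<Sigma> *\<^sub>v w)) / 2 = (\<Sum>j<d. w $ j * (x j - (ap j + am j) / 2))" for x
  proof -
    have "w \<bullet> (vec d x - \<nu>m) - (w \<bullet> (\<Sigma> *\<^sub>v w)) / 2
      = (\<Sum>j<d. w $ j * (x j - \<nu>m $ j)) - (\<Sum>j<d. w $ j * (\<Sigma> *\<^sub>v w) $ j) / 2"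
      using w \<nu> Swc S(1) by (auto simp: scalar_prod_def atLeast0LessThan)
    also have "\<dots> = (\<Sum>j<d. w $ j * (x j - \<nu>m $ j) - w $ j * (\<Sigma> *\<^sub>v w) $ j / 2)"
      by (simp only: sum_subtractf sum_divide_distrib)
    also have "\<dots> = (\<Sum>j<d. w $ j * (x j - (ap j + am j) / 2))"
    proof (rule sum.cong)
      fix j assume j: "j \<in> {..<d}"
      show "w $ j * (x j - \<nu>m $ j) - w $ j * (\<Sigma> *\<^sub>v w) $ j / 2 = w $ j * (x j - (ap j + am j) / 2)"
      proof (cases "j \<in> I")
        case True
        then show ?thesis using j unfolding Sw[OF True] by (simp add: \<nu>m_def field_simps)
      next
        case False
        then show ?thesis using w(2)[of j] j by simp
      qed
    qed simp
    finally show ?thesis .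
  qed
  have "H = {x \<in> space (covariate_space d). w \<bullet> (vec d x - \<nu>m) - (w \<bullet> (\<Sigma> *\<^sub>v w)) / 2 < 0}"
    unfolding score H_def ..
  then have opt: "measure (mvn d \<nu>m \<Sigma>) A - measure (mvn d \<nu>' \<Sigma>) A \<le> measure (mvn d \<nu>m \<Sigma>) H - measure (mvn d \<nu>' \<Sigma>) H"
    using mvn_tilt_region_optimal[OF \<nu>(2) w(1) A] by (simp add: \<nu>'_def)
  have \<nu>eq: "\<nu>' $ j = \<nu>p $ j" if "j \<in> I" for j
  proof -
    have j: "j < d" using that I by auto
    have "\<nu>' $ j = \<nu>m $ j + (\<Sigma> *\<^sub>v w) $ j" unfolding \<nu>'_def using j Swc S(1) by (subst index_add_vec) auto
    then show ?thesis using that j unfolding Sw[OF that] by (simp add: \<nu>m_def \<nu>p_def)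
  qed
  have A_eq: "measure (mvn d \<nu>' \<Sigma>) A = measure (mvn d \<nu>p \<Sigma>) A"
    by (rule mvn_cylinder_cong[OF \<nu>(3,1) A cyl I \<nu>eq])
  have H_eq: "measure (mvn d \<nu>' \<Sigma>) H = measure (mvn d \<nu>p \<Sigma>) H"
  proof (rule mvn_cylinder_cong[OF \<nu>(3,1) H _ I \<nu>eq])
    fix x y assume xy: "y \<in> space (covariate_space d)" "\<And>j. j \<in> I \<Longrightarrow> x j = y j" "x \<in> H"
    have "w $ j * (x j - (ap j + am j) / 2) = w $ j * (y j - (ap j + am j) / 2)" if "j < d" for j
      using xy(2)[of j] w(2)[OF that] by (cases "j \<in> I") auto
    then have "(\<Sum>j<d. w $ j * (x j - (ap j + am j) / 2)) = (\<Sum>j<d. w $ j * (y j - (ap j + am j) / 2))"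
      by (intro sum.cong) auto
    then show "y \<in> H" using xy(1,3) by (simp add: H_def)
  qed
  have sq: "(\<Sum>j<d. (\<nu>p $ j - \<mu>p $ j)\<^sup>2) = (\<Sum>j\<in>I. (ap j - \<mu>p $ j)\<^sup>2)"
    "(\<Sum>j<d. (\<nu>m $ j - \<mu>m $ j)\<^sup>2) = (\<Sum>j\<in>I. (am j - \<mu>m $ j)\<^sup>2)"
    "(\<Sum>j<d. (\<mu>p $ j - \<nu>p $ j)\<^sup>2) = (\<Sum>j\<in>I. (ap j - \<mu>p $ j)\<^sup>2)"
    "(\<Sum>j<d. (\<mu>m $ j - \<nu>m $ j)\<^sup>2) = (\<Sum>j\<in>I. (am j - \<mu>m $ j)\<^sup>2)"
    using I by (auto simp: \<nu>p_def \<nu>m_def power2_commute intro!: sum.mono_neutral_cong_right)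
  note tv = mvn_measure_diff_le[OF \<mu>(1) \<nu>(1) H] mvn_measure_diff_le[OF \<nu>(1) \<mu>(1) A]
    mvn_measure_diff_le[OF \<nu>(2) \<mu>(2) H] mvn_measure_diff_le[OF \<mu>(2) \<nu>(2) A]
  show ?thesis
    using tv[unfolded sq] opt[unfolded A_eq H_eq] by (simp add: add_divide_distrib ring_distribs)
qed

end

section \<open>Mean squared error of an average over the observed entries\<close>

lemma sum_over_subsets_by_card:
  assumes "finite A"
  shows "(\<Sum>S\<in>Pow A. F (card S)) = (\<Sum>k\<le>card A. of_nat (card A choose k) * (F k :: real))"
proof -
  have "(\<Sum>S\<in>Pow A. F (card S)) = (\<Sum>k\<le>card A. \<Sum>S\<in>{S\<in>Pow A. card S = k}. F (card S))"
    using assms by (intro sum.group[symmetric]) (auto intro: card_mono)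
  also have "\<dots> = (\<Sum>k\<le>card A. of_nat (card A choose k) * F k)"
  proof (rule sum.cong)
    fix k
    have "(\<Sum>S\<in>{S\<in>Pow A. card S = k}. F (card S)) = of_nat (card {S. S \<subseteq> A \<and> card S = k}) * F k"
      by (simp add: Pow_def)
    then show "(\<Sum>S\<in>{S\<in>Pow A. card S = k}. F (card S)) = of_nat (card A choose k) * F k"
      by (simp add: n_subsets[OF assms])
  qed simp
  finally show ?thesis .
qed

text \<open>
  A bound on \<open>p * E[1{N > 0} / N]\<close> for a Binomial \<open>N\<close>: since \<open>1 / k \<le> 2 / (k + 1)\<close> and
  \<open>(n choose k) / (k + 1) = (Suc n choose Suc k) / (n + 1)\<close>, the sum is dominated by \<open>2 / (n + 1)\<close> times
  part of the binomial expansion of \<open>(p + (1 - p))\<^sup>n\<^sup>+\<^sup>1\<close>. Keeping the factor \<open>p\<close> on the left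
  covers \<open>p = 0\<close>.
\<close>

lemma binomial_inverse_mean_le:
  fixes p :: real
  assumes p: "0 \<le> p" "p \<le> 1"
  shows "p * (\<Sum>k\<le>n. of_nat (n choose k) * (if k = 0 then 0 else p ^ k * (1 - p) ^ (n - k) / real k)) \<le> 2 / (real n + 1)"
proof -
  let ?q = "1 - p"
  have "p * (\<Sum>k\<le>n. of_nat (n choose k) * (if k = 0 then 0 else p ^ k * ?q ^ (n - k) / real k))
    = (\<Sum>k\<le>n. p * (of_nat (n choose k) * (if k = 0 then 0 else p ^ k * ?q ^ (n - k) / real k)))"
    by (rule sum_distrib_left)
  also have "\<dots> \<le> (\<Sum>k\<le>n. 2 / (real n + 1) * (of_nat (Suc n choose Suc k) * p ^ Suc k * ?q ^ (Suc n - Suc k)))"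
  proof (rule sum_mono)
    fix k assume k: "k \<in> {..n}"
    let ?t = "p ^ Suc k * ?q ^ (n - k)"
    have t: "0 \<le> ?t" using p by simp
    have "(real n + 1) * real (n choose k) = real (Suc n choose Suc k) * (real k + 1)"
      using Suc_times_binomial_eq[of n k] by (metis of_nat_mult of_nat_Suc add.commute)
    then have c: "real (n choose k) / (real k + 1) = real (Suc n choose Suc k) / (real n + 1)"
      by (simp add: field_simps)
    have "p * (of_nat (n choose k) * (if k = 0 then 0 else p ^ k * ?q ^ (n - k) / real k))
      = (if k = 0 then 0 else real (n choose k) * ?t * (1 / real k))"
      by simp
    also have "\<dots> \<le> real (n choose k) * ?t * (2 / (real k + 1))"
    proof (cases "k = 0")
      case False
      then have "1 / real k \<le> 2 / (real k + 1)" by (simp add: field_simps)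
      then have "real (n choose k) * ?t * (1 / real k) \<le> real (n choose k) * ?t * (2 / (real k + 1))"
        using t by (intro mult_left_mono) auto
      with False show ?thesis by simp
    qed (use t in auto)
    also have "\<dots> = 2 * ?t * (real (n choose k) / (real k + 1))" by simp
    also have "\<dots> = 2 / (real n + 1) * (of_nat (Suc n choose Suc k) * p ^ Suc k * ?q ^ (Suc n - Suc k))"
      unfolding c by simp
    finally show "p * (of_nat (n choose k) * (if k = 0 then 0 else p ^ k * ?q ^ (n - k) / real k))
      \<le> 2 / (real n + 1) * (of_nat (Suc n choose Suc k) * p ^ Suc k * ?q ^ (Suc n - Suc k))" .
  qed
  also have "\<dots> = 2 / (real n + 1) * (\<Sum>k\<le>n. of_nat (Suc n choose Suc k) * p ^ Suc k * ?q ^ (Suc n - Suc k))"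
    by (rule sum_distrib_left[symmetric])
  also have "\<dots> \<le> 2 / (real n + 1) * 1"
  proof (rule mult_left_mono)
    have "(\<Sum>k\<le>n. of_nat (Suc n choose Suc k) * p ^ Suc k * ?q ^ (Suc n - Suc k))
      \<le> (\<Sum>k\<le>Suc n. of_nat (Suc n choose k) * p ^ k * ?q ^ (Suc n - k))"
      unfolding sum.atMost_Suc_shift[of _ n] using p by simp
    also have "\<dots> = (p + ?q) ^ Suc n" by (rule binomial_ring[symmetric])
    finally show "(\<Sum>k\<le>n. of_nat (Suc n choose Suc k) * p ^ Suc k * ?q ^ (Suc n - Suc k)) \<le> 1" by simp
  qed simp
  finally show ?thesis by simp
qed

text \<open>
  The set of observed entries is random, and so is the denominator. Splitting over its possible values
  \<open>S\<close> leaves a fixed denominator and, after expanding the square, terms that are products of functions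
  of single sample points. For \<open>S = {}\<close> the average is \<open>0 / 0 = 0\<close>.
\<close>

lemma ratio_minus_center_square:
  fixes f :: "'a \<Rightarrow> real" and n :: nat
  shows "((\<Sum>i<n. f (D i) * of_bool (b (D i))) / (\<Sum>i<n. of_bool (b (D i))) - c)\<^sup>2
    = (\<Sum>S\<in>Pow {..<n}. of_bool (S = {i\<in>{..<n}. b (D i)}) *
        (if S = {} then c\<^sup>2 else (\<Sum>i\<in>S. \<Sum>l\<in>S. (f (D i) - c) * (f (D l) - c)) / (real (card S))\<^sup>2))"
proof -
  let ?S = "{i\<in>{..<n}. b (D i)}"
  have num: "(\<Sum>i<n. f (D i) * of_bool (b (D i))) = (\<Sum>i\<in>?S. f (D i))"
    by (intro sum.mono_neutral_cong_right) auto
  have den: "(\<Sum>i<n. of_bool (b (D i))) = real (card ?S)"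
    by (simp add: sum.inter_filter[symmetric] of_bool_def)
  have "(\<Sum>S\<in>Pow {..<n}. of_bool (S = ?S) *
        (if S = {} then c\<^sup>2 else (\<Sum>i\<in>S. \<Sum>l\<in>S. (f (D i) - c) * (f (D l) - c)) / (real (card S))\<^sup>2))
     = (\<Sum>S\<in>Pow {..<n}. if S = ?S then
        (if S = {} then c\<^sup>2 else (\<Sum>i\<in>S. \<Sum>l\<in>S. (f (D i) - c) * (f (D l) - c)) / (real (card S))\<^sup>2) else 0)"
    by (intro sum.cong) auto
  also have "\<dots> = (if ?S = {} then c\<^sup>2 else (\<Sum>i\<in>?S. \<Sum>l\<in>?S. (f (D i) - c) * (f (D l) - c)) / (real (card ?S))\<^sup>2)"
    by (subst sum.delta) auto
  also have "\<dots> = ((\<Sum>i\<in>?S. f (D i)) / real (card ?S) - c)\<^sup>2"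
  proof (cases "?S = {}")
    case True
    then show ?thesis by (simp del: Collect_empty_eq)
  next
    case False
    then have pos: "0 < real (card ?S)" by (simp add: card_gt_0_iff del: Collect_empty_eq)
    have "(\<Sum>i\<in>?S. \<Sum>l\<in>?S. (f (D i) - c) * (f (D l) - c)) = (\<Sum>i\<in>?S. f (D i) - c)\<^sup>2"
      by (simp add: power2_eq_square sum_product)
    also have "(\<Sum>i\<in>?S. f (D i) - c) = (\<Sum>i\<in>?S. f (D i)) - real (card ?S) * c"
      by (simp add: sum_subtractf)
    also have "((\<Sum>i\<in>?S. f (D i)) - real (card ?S) * c)\<^sup>2 / (real (card ?S))\<^sup>2
        = ((\<Sum>i\<in>?S. f (D i)) / real (card ?S) - c)\<^sup>2"
      unfolding power_divide[symmetric] diff_divide_distrib using pos by (simp only: nonzero_mult_div_cancel_left less_imp_neq[symmetric] not_False_eq_True)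
    finally show ?thesis unfolding if_not_P[OF False] .
  qed
  finally show ?thesis unfolding num den by simp
qed

text \<open>
  Given that the observed set is \<open>S\<close>, the centred entries are uncorrelated with variance \<open>s2\<close>, so
  the average over \<open>S\<close> has mean squared error \<open>s2 / card S\<close>. Independence enters through the
  factorization of the integral of a product over the sample points.
\<close>

lemma observed_mean_mse:
  fixes f :: "'a \<Rightarrow> real" and c s2 :: real and n :: nat
  assumes K: "prob_space K"
    and [measurable]: "Measurable.pred K b" "f \<in> borel_measurable K"
    and p: "p = measure K {x \<in> space K. b x}"
    and int1: "integrable K (\<lambda>x. of_bool (b x) * (f x - c))" and mean: "(\<integral>x. of_bool (b x) * (f x - c) \<partial>K) = 0"
    and int2: "integrable K (\<lambda>x. of_bool (b x) * (f x - c)\<^sup>2)" and var: "(\<integral>x. of_bool (b x) * (f x - c)\<^sup>2 \<partial>K) = p * s2"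
    and s2: "0 \<le> s2"
  defines "est \<equiv> \<lambda>D. (\<Sum>i<n. f (D i) * of_bool (b (D i))) / (\<Sum>i<n. of_bool (b (D i)))"
  shows "integrable (PiM {..<n} (\<lambda>_. K)) (\<lambda>D. (est D - c)\<^sup>2)" (is ?int)
    and "p * (\<integral>D. (est D - c)\<^sup>2 \<partial>PiM {..<n} (\<lambda>_. K)) \<le> p * (1 - p) ^ n * c\<^sup>2 + 2 * s2 / (real n + 1)" (is ?bound)
proof -
  interpret K: prob_space K by fact
  interpret P: product_prob_space "\<lambda>_::nat. K" ..
  let ?P = "PiM {..<n} (\<lambda>_. K)"
  \<comment> \<open>\<open>?pat S r\<close> is the factor of the \<open>r\<close>-th sample point in the event that the observed set is \<open>S\<close>;
    \<open>?g\<close> multiplies in the centred values at \<open>i\<close> and \<open>l\<close>\<close>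
  let ?pat = "\<lambda>S r x. if r \<in> S then of_bool (b x) else 1 - of_bool (b x) :: real"
  let ?g = "\<lambda>S i l r x. ?pat S r x * (if r = i then f x - c else 1) * (if r = l then f x - c else 1)"
  have p01: "0 \<le> p" "p \<le> 1" unfolding p by auto
  have intb: "integrable K (\<lambda>x. of_bool (b x) :: real)"
    by (rule K.integrable_const_bound[of _ 1]) auto
  have "(\<integral>x. indicator {x \<in> space K. b x} x \<partial>K) = p"
    unfolding p by simp
  also have "(\<integral>x. indicator {x \<in> space K. b x} x \<partial>K) = (\<integral>x. of_bool (b x) \<partial>K)"
    by (intro Bochner_Integration.integral_cong) (auto simp: indicator_def)
  finally have Eb: "(\<integral>x. of_bool (b x) \<partial>K) = p" .
  have pat_int: "integrable K (?pat S r)" for S and r :: nat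
    using intb by (cases "r \<in> S") simp_all
  have pat_E: "(\<integral>x. ?pat S r x \<partial>K) = (if r \<in> S then p else 1 - p)" for S and r :: nat
    using intb by (cases "r \<in> S") (simp_all add: Eb K.prob_space)
  have pat_prod: "(\<Prod>r<n. ?pat S r (D r)) = of_bool (S = {i\<in>{..<n}. b (D i)})" if S: "S \<in> Pow {..<n}" for S D
  proof (cases "S = {i\<in>{..<n}. b (D i)}")
    case True
    have "(\<Prod>r<n. ?pat S r (D r)) = (\<Prod>r<n. 1)" by (rule prod.cong) (auto simp: True)
    then show ?thesis using True by simp
  next
    case False
    then obtain r where "r < n" "r \<in> S \<longleftrightarrow> \<not> b (D r)" using S by auto
    then have "\<exists>r\<in>{..<n}. ?pat S r (D r) = 0" by (intro bexI[of _ r]) auto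
    then have "(\<Prod>r<n. ?pat S r (D r)) = 0" by (intro prod_zero) auto
    then show ?thesis using False by simp
  qed
  have g_int: "integrable K (?g S i l r)" if "i \<in> S" "l \<in> S" for S and i l r :: nat
  proof -
    consider "r = i" "r = l" | "r = i" "r \<noteq> l" | "r \<noteq> i" "r = l" | "r \<noteq> i" "r \<noteq> l" by blast
    then show ?thesis
    proof cases
      case 1
      then show ?thesis using int2 that by (simp add: power2_eq_square mult.assoc)
    next
      case 4
      then show ?thesis using pat_int[of r S] by simp
    qed (use int1 that in simp_all)
  qed
  have prod_int: "integrable ?P (\<lambda>D. \<Prod>r<n. ?g S i l r (D r))" if "i \<in> S" "l \<in> S" for S i l
    using g_int[OF that] by (intro P.product_integrable_prod) auto
  have split_prod: "(\<Prod>r<n. ?g S i l r (D r)) = of_bool (S = {i\<in>{..<n}. b (D i)}) * ((f (D i) - c) * (f (D l) - c))"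
    if "S \<in> Pow {..<n}" "i \<in> S" "l \<in> S" for S i l D
  proof -
    have "i < n" "l < n" using that by auto
    then show ?thesis by (simp add: prod.distrib pat_prod[OF that(1)] del: prod_constant)
  qed
  have pr: "(\<Prod>r<n. if r \<in> S then p else 1 - p) = p ^ card S * (1 - p) ^ (n - card S)" if S: "S \<in> Pow {..<n}" for S
  proof -
    have fin: "finite S" using S finite_subset by auto
    have "{..<n} \<inter> {r. r \<in> S} = S" "{..<n} \<inter> - {r. r \<in> S} = {..<n} - S" using S by auto
    then show ?thesis using S card_Diff_subset[OF fin, of "{..<n}"] by (simp add: prod.If_cases)
  qed
  have E_prod: "(\<integral>D. (\<Prod>r<n. ?g S i l r (D r)) \<partial>?P) = (if i = l then s2 * (p ^ card S * (1 - p) ^ (n - card S)) else 0)"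
    if S: "S \<in> Pow {..<n}" and i: "i \<in> S" and l: "l \<in> S" for S i l
  proof -
    have "(\<integral>D. (\<Prod>r<n. ?g S i l r (D r)) \<partial>?P) = (\<Prod>r<n. \<integral>x. ?g S i l r x \<partial>K)"
      using g_int[OF i l] by (intro P.product_integral_prod) auto
    also have "\<dots> = (if i = l then s2 * (p ^ card S * (1 - p) ^ (n - card S)) else 0)"
    proof (cases "i = l")
      case False
      have "(\<integral>x. ?g S i l i x \<partial>K) = 0" using False i mean by simp
      moreover have "i \<in> {..<n}" using S i by auto
      ultimately have "(\<Prod>r<n. \<integral>x. ?g S i l r x \<partial>K) = 0" by (intro prod_zero) blast+
      then show ?thesis using False by simp
    next
      case True
      have "(\<Prod>r<n. \<integral>x. ?g S i l r x \<partial>K) = (\<Prod>r<n. (if r \<in> S then p else 1 - p) * (if r = i then s2 else 1))"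
      proof (rule prod.cong)
        fix r
        show "(\<integral>x. ?g S i l r x \<partial>K) = (if r \<in> S then p else 1 - p) * (if r = i then s2 else 1)"
        proof (cases "r = i")
          case ri: True
          then have "(\<integral>x. ?g S i l r x \<partial>K) = (\<integral>x. of_bool (b x) * (f x - c)\<^sup>2 \<partial>K)"
            using i True by (intro Bochner_Integration.integral_cong) (auto simp: power2_eq_square)
          then show ?thesis using ri i var by simp
        next
          case False
          then have "(\<integral>x. ?g S i l r x \<partial>K) = (\<integral>x. ?pat S r x \<partial>K)"
            using True by (intro Bochner_Integration.integral_cong) auto
          then show ?thesis using False by (simp only: pat_E) simp
        qed
      qed simp
      also have "\<dots> = s2 * (p ^ card S * (1 - p) ^ (n - card S))"
      proof -
        have "i < n" using S i by auto
        then show ?thesis by (simp add: prod.distrib pr[OF S])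
      qed
      finally show ?thesis using True by simp
    qed
    finally show ?thesis .
  qed
  let ?term = "\<lambda>S D. of_bool (S = {i\<in>{..<n}. b (D i)}) *
        (if S = {} then c\<^sup>2 else (\<Sum>i\<in>S. \<Sum>l\<in>S. (f (D i) - c) * (f (D l) - c)) / (real (card S))\<^sup>2)"
  have term0: "?term {} = (\<lambda>D. (\<Prod>r<n. ?pat {} r (D r)) * c\<^sup>2)"
    using pat_prod[of "{}"] by (intro ext) simp
  have term1: "?term S = (\<lambda>D. (\<Sum>i\<in>S. \<Sum>l\<in>S. \<Prod>r<n. ?g S i l r (D r)) / (real (card S))\<^sup>2)"
    if "S \<in> Pow {..<n}" "S \<noteq> {}" for S
  proof
    fix D
    have "(\<Sum>i\<in>S. \<Sum>l\<in>S. \<Prod>r<n. ?g S i l r (D r))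
      = (\<Sum>i\<in>S. \<Sum>l\<in>S. of_bool (S = {i\<in>{..<n}. b (D i)}) * ((f (D i) - c) * (f (D l) - c)))"
      by (intro sum.cong refl split_prod that)
    then show "?term S D = (\<Sum>i\<in>S. \<Sum>l\<in>S. \<Prod>r<n. ?g S i l r (D r)) / (real (card S))\<^sup>2"
      using that(2) by (simp only: sum_distrib_left[symmetric]) simp
  qed
  have pat0: "integrable ?P (\<lambda>D. \<Prod>r<n. ?pat {} r (D r))"
    by (rule P.product_integrable_prod[OF finite_lessThan pat_int])
  have term_int: "integrable ?P (?term S)" if S: "S \<in> Pow {..<n}" for S
  proof (cases "S = {}")
    case True
    then show ?thesis unfolding True term0 using pat0 by simp
  next
    case False
    show ?thesis unfolding term1[OF S False] using prod_int by (intro Bochner_Integration.integrable_sum integrable_divide) auto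
  qed
  let ?h = "\<lambda>k. if k = 0 then 0 else p ^ k * (1 - p) ^ (n - k) / real k"
  have term_E: "(\<integral>D. ?term S D \<partial>?P) = (if S = {} then (1 - p) ^ n * c\<^sup>2 else 0) + s2 * ?h (card S)"
    if S: "S \<in> Pow {..<n}" for S
  proof (cases "S = {}")
    case True
    have "(\<integral>D. (\<Prod>r<n. ?pat {} r (D r)) \<partial>?P) = (\<Prod>r<n. \<integral>x. ?pat {} r x \<partial>K)"
      by (rule P.product_integral_prod[OF finite_lessThan pat_int])
    also have "\<dots> = (1 - p) ^ n" by (simp only: pat_E) simp
    finally show ?thesis unfolding True term0 by simp
  next
    case False
    have fin: "finite S" using S finite_subset by auto
    then have card: "0 < card S" using False by (simp add: card_gt_0_iff)
    have "(\<integral>D. ?term S D \<partial>?P) = (\<Sum>i\<in>S. \<Sum>l\<in>S. \<integral>D. (\<Prod>r<n. ?g S i l r (D r)) \<partial>?P) / (real (card S))\<^sup>2"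
      unfolding term1[OF S False] using prod_int by (subst integral_divide_zero) (simp add: Bochner_Integration.integral_sum)
    also have "(\<Sum>i\<in>S. \<Sum>l\<in>S. \<integral>D. (\<Prod>r<n. ?g S i l r (D r)) \<partial>?P)
      = (\<Sum>i\<in>S. \<Sum>l\<in>S. if i = l then s2 * (p ^ card S * (1 - p) ^ (n - card S)) else 0)"
      by (intro sum.cong refl E_prod S)
    also have "\<dots> = real (card S) * (s2 * (p ^ card S * (1 - p) ^ (n - card S)))"
      using fin by simp
    also have "\<dots> / (real (card S))\<^sup>2 = s2 * ?h (card S)"
      using card by (simp add: power2_eq_square)
    finally show ?thesis using False by simp
  qed
  have est: "(est D - c)\<^sup>2 = (\<Sum>S\<in>Pow {..<n}. ?term S D)" for D
    unfolding est_def by (rule ratio_minus_center_square)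
  show ?int unfolding est by (intro Bochner_Integration.integrable_sum term_int)
  have "(\<integral>D. (est D - c)\<^sup>2 \<partial>?P) = (\<Sum>S\<in>Pow {..<n}. \<integral>D. ?term S D \<partial>?P)"
    unfolding est by (intro Bochner_Integration.integral_sum term_int)
  also have "\<dots> = (\<Sum>S\<in>Pow {..<n}. (if S = {} then (1 - p) ^ n * c\<^sup>2 else 0) + s2 * ?h (card S))"
    by (intro sum.cong refl term_E)
  also have "\<dots> = (1 - p) ^ n * c\<^sup>2 + s2 * (\<Sum>S\<in>Pow {..<n}. ?h (card S))"
    by (simp add: sum.distrib sum_distrib_left)
  also have "(\<Sum>S\<in>Pow {..<n}. ?h (card S)) = (\<Sum>k\<le>n. of_nat (n choose k) * ?h k)"
    using sum_over_subsets_by_card[of "{..<n}" ?h] by simp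
  finally have E: "(\<integral>D. (est D - c)\<^sup>2 \<partial>?P) = (1 - p) ^ n * c\<^sup>2 + s2 * (\<Sum>k\<le>n. of_nat (n choose k) * ?h k)" .
  have "s2 * (p * (\<Sum>k\<le>n. of_nat (n choose k) * ?h k)) \<le> s2 * (2 / (real n + 1))"
    by (intro mult_left_mono binomial_inverse_mean_le p01 s2)
  then show ?bound unfolding E by (simp add: algebra_simps)
qed

section \<open>Conditioning on the pattern and on the label\<close>

abbreviation mask_patterns :: "nat \<Rightarrow> mask set" where
  "mask_patterns d \<equiv> PiE {..<d} (\<lambda>_. UNIV)"

lemma mask_space_eq: "mask_space d = count_space (mask_patterns d)"
  by (rule count_space_PiM_finite) auto

lemma finite_mask_patterns: "finite (mask_patterns d)"
  by (intro finite_PiE) auto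

text \<open>
  A rule is identified with the region \<open>A\<close> of observations where it predicts \<open>-1\<close>; the section is
  the set of complete covariates on which it does so when the pattern is \<open>m\<close>.
\<close>

definition pattern_section :: "nat \<Rightarrow> mask \<Rightarrow> obs_point set \<Rightarrow> (nat \<Rightarrow> real) set" where
  "pattern_section d m A = {x \<in> space (covariate_space d). (restrict x (obs d m), m) \<in> A}"

lemma measurable_restrict_obs:
  "(\<lambda>x. restrict x (obs d m)) \<in> measurable (covariate_space d) (covariate_space d)"
proof -
  have "(\<lambda>x. \<lambda>j\<in>{..<d}. if m j then undefined else x j) \<in> measurable (covariate_space d) (covariate_space d)"
    by (intro measurable_restrict) measurable
  also have "(\<lambda>x. \<lambda>j\<in>{..<d}. if m j then undefined else x j) = (\<lambda>x. restrict x (obs d m))"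
    by (auto simp: obs_def fun_eq_iff)
  finally show ?thesis .
qed

lemma pattern_section_measurable:
  assumes "m \<in> mask_patterns d" and [measurable]: "A \<in> sets (obs_space d)"
  shows "pattern_section d m A \<in> sets (covariate_space d)"
proof -
  note [measurable] = measurable_restrict_obs
  have "m \<in> space (mask_space d)" using assms(1) by (simp add: space_PiM)
  then show ?thesis unfolding pattern_section_def by measurable
qed

lemma pattern_section_cylinder:
  assumes "y \<in> space (covariate_space d)" "\<And>j. j \<in> obs d m \<Longrightarrow> x j = y j" "x \<in> pattern_section d m A"
  shows "y \<in> pattern_section d m A"
proof -
  have "restrict x (obs d m) = restrict y (obs d m)" using assms(2) by (intro restrict_ext)
  then show ?thesis using assms by (simp add: pattern_section_def)
qed

context lda_mcar_model
begin

lemma covariate_measurable [measurable]: "covariate \<in> measurable Q (covariate_space d)"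
  and missing_measurable [measurable]: "missing \<in> measurable Q (mask_space d)"
  and label_measurable [measurable]: "label \<in> measurable Q label_space"
  by (simp_all add: measurable_cong_sets[OF sets_law refl])

lemma label_eq_measurable [measurable]: "Measurable.pred Q (\<lambda>\<omega>. label \<omega> = k)"
  by (rule measurable_compose[OF label_measurable]) simp

lemma label_cases: "\<omega> \<in> space Q \<Longrightarrow> label \<omega> = 1 \<or> label \<omega> = -1"
  using measurable_space[OF label_measurable, of \<omega>] by auto

lemma label_prob:
  assumes "k \<in> {-1, 1}"
  shows "prob {\<omega> \<in> space Q. label \<omega> = k} = 1 / 2"
proof -
  have "1 = prob ({\<omega> \<in> space Q. label \<omega> = 1} \<union> {\<omega> \<in> space Q. label \<omega> = -1})"
    unfolding prob_space[symmetric] by (intro arg_cong[where f = prob]) (auto dest: label_cases)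
  also have "\<dots> = prob {\<omega> \<in> space Q. label \<omega> = 1} + prob {\<omega> \<in> space Q. label \<omega> = -1}"
    by (intro finite_measure_Union) auto
  finally show ?thesis using balanced assms by auto
qed

lemma class_conditional_law:
  assumes k: "k \<in> {-1, 1}"
  shows "distr (uniform_measure Q {\<omega> \<in> space Q. label \<omega> = k}) (covariate_space d) covariate = mvn d (\<mu> k) \<Sigma>"
proof -
  have "distr (uniform_measure Q {\<omega> \<in> space Q. label \<omega> = k}) (covariate_space d) covariate
    = distr (uniform_measure Q {\<omega> \<in> space Q. label \<omega> = k}) (PiM {..<d} (\<lambda>_. lborel)) covariate"
    by (intro distr_cong refl) (simp add: sets_PiM_lborel)
  also have "\<dots> = mvn d (\<mu> k) \<Sigma>"
    unfolding mvn_def by (rule distributed_distr_eq_density[OF class_gaussian[OF k]])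
  finally show ?thesis .
qed

sublocale gaussian_family d \<Sigma>
proof
  show "1 \<le> d" "sym_pos_def d \<Sigma>" by (fact dim_pos, fact cov_pos_def)
  have "prob_space (mvn d (\<mu> 1) \<Sigma>)"
    unfolding class_conditional_law[of 1, simplified, symmetric]
  proof (rule prob_space.prob_space_distr)
    show "prob_space (uniform_measure Q {\<omega> \<in> space Q. label \<omega> = 1})"
      using label_prob[of 1] by (intro prob_space_uniform_measure) (auto simp: emeasure_eq_measure)
  qed simp
  then show "\<exists>\<mu>\<^sub>0\<in>carrier_vec d. prob_space (mvn d \<mu>\<^sub>0 \<Sigma>)"
    using mean_dim[of 1] by (intro bexI[of _ "\<mu> 1"]) auto
qed

lemma mean_carrier: "\<mu> 1 \<in> carrier_vec d" "\<mu> (-1) \<in> carrier_vec d"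
  using mean_dim by auto

lemma prob_mask_label_covariate:
  assumes k: "k \<in> {-1, 1}" and U: "U \<in> sets (mask_space d)" and S: "S \<in> sets (covariate_space d)"
  shows "prob {\<omega> \<in> space Q. missing \<omega> \<in> U \<and> label \<omega> = k \<and> covariate \<omega> \<in> S}
    = prob {\<omega> \<in> space Q. missing \<omega> \<in> U} / 2 * measure (mvn d (\<mu> k) \<Sigma>) S"
proof -
  note [measurable] = U S
  let ?E = "{\<omega> \<in> space Q. label \<omega> = k}"
  have E [measurable]: "?E \<in> sets Q" by measurable
  have mU: "{\<omega> \<in> space Q. missing \<omega> \<in> U} \<in> sets (vimage_algebra (space Q) missing (mask_space d))"
  proof -
    have "missing -` U \<inter> space Q \<in> sets (vimage_algebra (space Q) missing (mask_space d))"
      using U by (rule in_vimage_algebra)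
    then show ?thesis by (simp add: vimage_def Int_def conj_commute)
  qed
  have S': "S \<times> {k} \<in> sets (covariate_space d \<Otimes>\<^sub>M label_space)"
    using S k by (intro pair_measureI) auto
  have mS: "{\<omega> \<in> space Q. label \<omega> = k \<and> covariate \<omega> \<in> S}
      \<in> sets (vimage_algebra (space Q) (\<lambda>\<omega>. (covariate \<omega>, label \<omega>)) (covariate_space d \<Otimes>\<^sub>M label_space))"
  proof -
    have "(\<lambda>\<omega>. (covariate \<omega>, label \<omega>)) -` (S \<times> {k}) \<inter> space Q
        \<in> sets (vimage_algebra (space Q) (\<lambda>\<omega>. (covariate \<omega>, label \<omega>)) (covariate_space d \<Otimes>\<^sub>M label_space))"
      using S' by (rule in_vimage_algebra)
    moreover have "(\<lambda>\<omega>. (covariate \<omega>, label \<omega>)) -` (S \<times> {k}) \<inter> space Q = {\<omega> \<in> space Q. label \<omega> = k \<and> covariate \<omega> \<in> S}"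
      by auto
    ultimately show ?thesis by simp
  qed
  have "prob {\<omega> \<in> space Q. missing \<omega> \<in> U \<and> label \<omega> = k \<and> covariate \<omega> \<in> S}
    = prob ({\<omega> \<in> space Q. missing \<omega> \<in> U} \<inter> {\<omega> \<in> space Q. label \<omega> = k \<and> covariate \<omega> \<in> S})"
    by (intro arg_cong[where f = prob]) auto
  also have "\<dots> = prob {\<omega> \<in> space Q. missing \<omega> \<in> U} * prob {\<omega> \<in> space Q. label \<omega> = k \<and> covariate \<omega> \<in> S}"
    by (rule indep_setD[OF mask_indep_data mU mS])
  also have "prob {\<omega> \<in> space Q. label \<omega> = k \<and> covariate \<omega> \<in> S} = measure (mvn d (\<mu> k) \<Sigma>) S / 2"
  proof -
    have "measure (mvn d (\<mu> k) \<Sigma>) S = measure (uniform_measure Q ?E) (covariate -` S \<inter> space Q)"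
      unfolding class_conditional_law[OF k, symmetric] by (subst measure_distr) auto
    also have "\<dots> = prob (?E \<inter> (covariate -` S \<inter> space Q)) / prob ?E"
      using label_prob[OF k] by (intro measure_uniform_measure) (auto simp: emeasure_eq_measure)
    also have "?E \<inter> (covariate -` S \<inter> space Q) = {\<omega> \<in> space Q. label \<omega> = k \<and> covariate \<omega> \<in> S}" by auto
    finally show ?thesis using label_prob[OF k] by simp
  qed
  finally show ?thesis by simp
qed

text \<open>
  The mask is independent of covariate and label, so restricting \<open>Q\<close> to an event on the mask and to a
  class leaves the Gaussian law of that class, up to the mass of the event.
\<close>

lemma covariate_law_on_mask_label:
  assumes k: "k \<in> {-1, 1}" and U [measurable]: "U \<in> sets (mask_space d)"
  shows "distr (density Q (\<lambda>\<omega>. ennreal (of_bool (missing \<omega> \<in> U \<and> label \<omega> = k)))) (covariate_space d) covariate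
    = density (mvn d (\<mu> k) \<Sigma>) (\<lambda>_. ennreal (prob {\<omega> \<in> space Q. missing \<omega> \<in> U} / 2))"
    (is "distr (density Q ?I) _ _ = density _ (\<lambda>_. ennreal ?c)")
proof (rule measure_eqI)
  interpret P: prob_space "mvn d (\<mu> k) \<Sigma>" using mean_dim[OF k] by (rule prob_space_mvn)
  fix S assume "S \<in> sets (distr (density Q ?I) (covariate_space d) covariate)"
  then have S [measurable]: "S \<in> sets (covariate_space d)" by simp
  have "emeasure (distr (density Q ?I) (covariate_space d) covariate) S
    = emeasure (density Q ?I) (covariate -` S \<inter> space Q)"
    by (subst emeasure_distr) auto
  also have "\<dots> = (\<integral>\<^sup>+\<omega>. ?I \<omega> * indicator (covariate -` S \<inter> space Q) \<omega> \<partial>Q)"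
    by (rule emeasure_density) measurable
  also have "\<dots> = (\<integral>\<^sup>+\<omega>. indicator {\<omega> \<in> space Q. missing \<omega> \<in> U \<and> label \<omega> = k \<and> covariate \<omega> \<in> S} \<omega> \<partial>Q)"
    by (intro nn_integral_cong) (auto simp: indicator_def)
  also have "\<dots> = emeasure Q {\<omega> \<in> space Q. missing \<omega> \<in> U \<and> label \<omega> = k \<and> covariate \<omega> \<in> S}"
    by (rule nn_integral_indicator) measurable
  also have "\<dots> = ennreal (?c * measure (mvn d (\<mu> k) \<Sigma>) S)"
    unfolding emeasure_eq_measure prob_mask_label_covariate[OF k U S] ..
  also have "\<dots> = emeasure (density (mvn d (\<mu> k) \<Sigma>) (\<lambda>_. ennreal ?c)) S"
    by (subst emeasure_density_const) (simp_all add: P.emeasure_eq_measure ennreal_mult'[symmetric])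
  finally show "emeasure (distr (density Q ?I) (covariate_space d) covariate) S
    = emeasure (density (mvn d (\<mu> k) \<Sigma>) (\<lambda>_. ennreal ?c)) S" .
qed simp

lemma integral_on_mask_label:
  fixes f :: "(nat \<Rightarrow> real) \<Rightarrow> real"
  assumes k: "k \<in> {-1, 1}" and U [measurable]: "U \<in> sets (mask_space d)"
    and f: "integrable (mvn d (\<mu> k) \<Sigma>) f"
  shows "integrable Q (\<lambda>\<omega>. of_bool (missing \<omega> \<in> U \<and> label \<omega> = k) * f (covariate \<omega>))"
    and "(\<integral>\<omega>. of_bool (missing \<omega> \<in> U \<and> label \<omega> = k) * f (covariate \<omega>) \<partial>Q)
      = prob {\<omega> \<in> space Q. missing \<omega> \<in> U} / 2 * (\<integral>x. f x \<partial>mvn d (\<mu> k) \<Sigma>)"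
proof -
  let ?c = "prob {\<omega> \<in> space Q. missing \<omega> \<in> U} / 2"
  let ?I = "\<lambda>\<omega>. of_bool (missing \<omega> \<in> U \<and> label \<omega> = k) :: real"
  have [measurable]: "f \<in> borel_measurable (covariate_space d)"
    using borel_measurable_integrable[OF f] by simp
  have I [measurable]: "?I \<in> borel_measurable Q" by measurable
  let ?D = "distr (density Q (\<lambda>\<omega>. ennreal (?I \<omega>))) (covariate_space d) covariate"
  have "integrable (density (mvn d (\<mu> k) \<Sigma>) (\<lambda>_. ennreal ?c)) f"
    using f by (subst integrable_density) auto
  then have "integrable ?D f"
    unfolding covariate_law_on_mask_label[OF k U] .
  then have "integrable (density Q (\<lambda>\<omega>. ennreal (?I \<omega>))) (\<lambda>\<omega>. f (covariate \<omega>))"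
    by (subst (asm) integrable_distr_eq) auto
  then show "integrable Q (\<lambda>\<omega>. ?I \<omega> * f (covariate \<omega>))"
    by (subst (asm) integrable_density) auto
  have "(\<integral>\<omega>. ?I \<omega> * f (covariate \<omega>) \<partial>Q) = (\<integral>\<omega>. f (covariate \<omega>) \<partial>density Q (\<lambda>\<omega>. ennreal (?I \<omega>)))"
    by (subst integral_density) auto
  also have "\<dots> = (\<integral>x. f x \<partial>?D)"
    by (rule integral_distr[symmetric]) auto
  also have "\<dots> = (\<integral>x. f x \<partial>density (mvn d (\<mu> k) \<Sigma>) (\<lambda>_. ennreal ?c))"
    unfolding covariate_law_on_mask_label[OF k U] ..
  also have "\<dots> = ?c * (\<integral>x. f x \<partial>mvn d (\<mu> k) \<Sigma>)"
    by (subst integral_density) auto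
  finally show "(\<integral>\<omega>. ?I \<omega> * f (covariate \<omega>) \<partial>Q) = ?c * (\<integral>x. f x \<partial>mvn d (\<mu> k) \<Sigma>)" .
qed

end

section \<open>Error of the estimated means\<close>

lemma (in gaussian_family) coordinate_moments:
  assumes \<mu>: "\<mu> \<in> carrier_vec d" and j: "j < d"
  shows "integrable (mvn d \<mu> \<Sigma>) (\<lambda>x. x j - \<mu> $ j)" "(\<integral>x. x j - \<mu> $ j \<partial>mvn d \<mu> \<Sigma>) = 0"
    "integrable (mvn d \<mu> \<Sigma>) (\<lambda>x. (x j - \<mu> $ j)\<^sup>2)" "(\<integral>x. (x j - \<mu> $ j)\<^sup>2 \<partial>mvn d \<mu> \<Sigma>) = \<Sigma> $$ (j, j)"
    "0 < \<Sigma> $$ (j, j)"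
proof -
  note S = sym_pos_defD[OF spd]
  let ?e = "unit_vec d j :: real vec"
  have e: "?e \<in> carrier_vec d" "?e \<noteq> 0\<^sub>v d"
    using j by (auto dest!: arg_cong[where f = "\<lambda>v. v $ j"])
  have var: "?e \<bullet> (\<Sigma> *\<^sub>v ?e) = \<Sigma> $$ (j, j)"
    using S(1) j by simp
  show pos: "0 < \<Sigma> $$ (j, j)" using S(3)[OF e] var by simp
  let ?s = "sqrt (\<Sigma> $$ (j, j))"
  have s: "0 < ?s" using pos by simp
  let ?X = "\<lambda>x. x j - \<mu> $ j"
  have X: "?e \<bullet> (vec d x - \<mu>) = ?X x" for x :: "nat \<Rightarrow> real"
    using \<mu> j by simp
  have meas [measurable]: "?X \<in> borel_measurable (mvn d \<mu> \<Sigma>)"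
    using j by simp
  have law: "distr (mvn d \<mu> \<Sigma>) borel ?X = density lborel (normal_density 0 ?s)"
    using distr_linear_functional[OF \<mu> e] unfolding X var .
  have int: "integrable (mvn d \<mu> \<Sigma>) (\<lambda>x. f (?X x))" and eq: "(\<integral>x. f (?X x) \<partial>mvn d \<mu> \<Sigma>) = I"
    if [measurable]: "f \<in> borel_measurable borel" and "has_bochner_integral lborel (\<lambda>x. normal_density 0 ?s x * f x) I"
    for f :: "real \<Rightarrow> real" and I
  proof -
    have "integrable (density lborel (normal_density 0 ?s)) f"
      using that(2) by (subst integrable_density) (auto simp: has_bochner_integral_iff)
    then show "integrable (mvn d \<mu> \<Sigma>) (\<lambda>x. f (?X x))"
      unfolding law[symmetric] by (subst (asm) integrable_distr_eq) auto
    have "(\<integral>x. f (?X x) \<partial>mvn d \<mu> \<Sigma>) = (\<integral>x. f x \<partial>distr (mvn d \<mu> \<Sigma>) borel ?X)"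
      by (rule integral_distr[symmetric]) auto
    also have "\<dots> = I"
      unfolding law using that(2) by (subst integral_density) (auto simp: has_bochner_integral_iff)
    finally show "(\<integral>x. f (?X x) \<partial>mvn d \<mu> \<Sigma>) = I" .
  qed
  have m1: "has_bochner_integral lborel (\<lambda>x. normal_density 0 ?s x * x) 0"
    using normal_moment_odd[OF s, of 0 0] by simp
  have m2: "has_bochner_integral lborel (\<lambda>x. normal_density 0 ?s x * x\<^sup>2) (\<Sigma> $$ (j, j))"
    using normal_moment_even[OF s, of 0 1] pos by (simp add: fact_numeral)
  show "integrable (mvn d \<mu> \<Sigma>) ?X" "(\<integral>x. ?X x \<partial>mvn d \<mu> \<Sigma>) = 0"
    by (rule int[OF _ m1], simp) (rule eq[OF _ m1], simp)
  show "integrable (mvn d \<mu> \<Sigma>) (\<lambda>x. (?X x)\<^sup>2)" "(\<integral>x. (?X x)\<^sup>2 \<partial>mvn d \<mu> \<Sigma>) = \<Sigma> $$ (j, j)"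
    by (rule int[OF _ m2], simp) (rule eq[OF _ m2], simp)
qed

context lda_mcar_model
begin

lemma missing_coordinate_measurable [measurable]:
  "j < d \<Longrightarrow> Measurable.pred Q (\<lambda>\<omega>. missing \<omega> j)"
  by (rule measurable_compose[OF missing_measurable]) simp

lemma observed_prob:
  assumes j: "j < d"
  shows "prob {\<omega> \<in> space Q. \<not> missing \<omega> j} = 1 - \<eta>"
proof -
  note [measurable] = missing_coordinate_measurable[OF j]
  have "prob {\<omega> \<in> space Q. \<not> missing \<omega> j} = measure (distr Q (count_space UNIV) (\<lambda>\<omega>. missing \<omega> j)) {False}"
    by (subst measure_distr) (auto intro!: arg_cong[where f = prob])
  also have "\<dots> = 1 - \<eta>"
    unfolding mask_bernoulli[OF j] using eta_range by (simp add: measure_pmf_single)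
  finally show ?thesis .
qed

lemma observe_measurable [measurable]: "observe d \<in> measurable Q (obs_space d)"
proof -
  have "(\<lambda>\<omega>. \<lambda>j\<in>{..<d}. if missing \<omega> j then undefined else covariate \<omega> j) \<in> measurable Q (covariate_space d)"
  proof (rule measurable_restrict)
    fix j assume "j \<in> {..<d}"
    then have "j < d" by simp
    note [measurable] = missing_coordinate_measurable[OF this]
    have [measurable]: "(\<lambda>\<omega>. covariate \<omega> j) \<in> borel_measurable Q"
      using \<open>j < d\<close> by (intro measurable_compose[OF covariate_measurable]) simp
    show "(\<lambda>\<omega>. if missing \<omega> j then undefined else covariate \<omega> j) \<in> borel_measurable Q"
      by measurable
  qed
  moreover have "(\<lambda>\<omega>. \<lambda>j\<in>{..<d}. if missing \<omega> j then undefined else covariate \<omega> j)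
     = (\<lambda>\<omega>. restrict (covariate \<omega>) (obs d (missing \<omega>)))"
    by (auto simp: obs_def fun_eq_iff)
  ultimately have "(\<lambda>\<omega>. restrict (covariate \<omega>) (obs d (missing \<omega>))) \<in> measurable Q (covariate_space d)"
    by simp
  from measurable_Pair[OF this missing_measurable] show ?thesis
    by (simp add: observe_def[abs_def])
qed

lemma prob_space_incomplete_law: "prob_space (incomplete_law d Q)"
  unfolding incomplete_law_def by (rule prob_space_distr) measurable

lemma sets_incomplete_law [measurable_cong, simp]:
  "sets (incomplete_law d Q) = sets (obs_space d \<Otimes>\<^sub>M label_space)"
  by (simp add: incomplete_law_def)

text \<open>
  An instance of \<open>observed_mean_mse\<close>: an entry is used when its label is \<open>k\<close> and its coordinate \<open>j\<close> is
  observed, which has probability \<open>(1 - \<eta>) / 2\<close>, and under this event it is \<open>N(\<mu>\<^sub>k\<^sub>,\<^sub>j, \<Sigma>\<^sub>j\<^sub>j)\<close>.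
\<close>

lemma mu_hat_mse:
  assumes k: "k \<in> {-1, 1}" and j: "j < d"
  shows "integrable (PiM {..<n} (\<lambda>_. incomplete_law d Q)) (\<lambda>D. (mu_hat n D k j - \<mu> k $ j)\<^sup>2)"
    and "(1 - \<eta>) * (\<integral>D. (mu_hat n D k j - \<mu> k $ j)\<^sup>2 \<partial>PiM {..<n} (\<lambda>_. incomplete_law d Q))
      \<le> (1 - \<eta>) * ((1 + \<eta>) / 2) ^ n * (\<mu> k $ j)\<^sup>2 + 4 * \<Sigma> $$ (j, j) / (real n + 1)"
proof -
  let ?K = "incomplete_law d Q" and ?b = "\<lambda>z. snd z = k \<and> \<not> snd (fst z) j"
    and ?f = "\<lambda>z. fst (fst z) j" and ?c = "\<mu> k $ j" and ?p = "(1 - \<eta>) / 2"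
  let ?U = "{m \<in> space (mask_space d). \<not> m j}"
  interpret K: prob_space ?K by (rule prob_space_incomplete_law)
  have jd: "j \<in> {..<d}" using j by simp
  have m_j [measurable]: "Measurable.pred (mask_space d) (\<lambda>m. m j)"
    and x_j [measurable]: "(\<lambda>x. x j) \<in> borel_measurable (covariate_space d)"
    by (rule measurable_component_singleton[OF jd])+
  have U [measurable]: "?U \<in> sets (mask_space d)" by measurable
  have T: "(\<lambda>\<omega>. (observe d \<omega>, label \<omega>)) \<in> measurable Q (obs_space d \<Otimes>\<^sub>M label_space)" by measurable
  have mU: "missing \<omega> \<in> ?U \<longleftrightarrow> \<not> missing \<omega> j" if "\<omega> \<in> space Q" for \<omega>
    using measurable_space[OF missing_measurable that] by simp
  have PU: "prob {\<omega> \<in> space Q. missing \<omega> \<in> ?U} = 1 - \<eta>"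
    unfolding observed_prob[OF j, symmetric] by (intro arg_cong[where f = prob]) (use mU in blast)
  have b [measurable]: "Measurable.pred (obs_space d \<Otimes>\<^sub>M label_space) ?b"
  proof -
    have [measurable]: "Measurable.pred label_space (\<lambda>y. y = k)" by simp
    show ?thesis by measurable
  qed
  have f [measurable]: "?f \<in> borel_measurable (obs_space d \<Otimes>\<^sub>M label_space)"
    by measurable
  have obs_j: "of_bool (?b (observe d \<omega>, label \<omega>)) * g (?f (observe d \<omega>, label \<omega>))
     = of_bool (missing \<omega> \<in> ?U \<and> label \<omega> = k) * g (covariate \<omega> j)" if "\<omega> \<in> space Q" for \<omega> and g :: "real \<Rightarrow> real"
    using mU[OF that] j by (auto simp: observe_def obs_def)
  have pull: "integrable ?K (\<lambda>z. of_bool (?b z) * g (?f z))"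
    "(\<integral>z. of_bool (?b z) * g (?f z) \<partial>?K) = ?p * (\<integral>x. g (x j) \<partial>mvn d (\<mu> k) \<Sigma>)"
    if g [measurable]: "g \<in> borel_measurable borel" and int: "integrable (mvn d (\<mu> k) \<Sigma>) (\<lambda>x. g (x j))"
    for g :: "real \<Rightarrow> real"
  proof -
    note on = integral_on_mask_label[OF k U int]
    have "integrable Q (\<lambda>\<omega>. of_bool (?b (observe d \<omega>, label \<omega>)) * g (?f (observe d \<omega>, label \<omega>)))"
      using on(1) by (subst Bochner_Integration.integrable_cong[OF refl obs_j]) auto
    then show "integrable ?K (\<lambda>z. of_bool (?b z) * g (?f z))"
      unfolding incomplete_law_def by (subst integrable_distr_eq[OF T]) auto
    have "(\<integral>z. of_bool (?b z) * g (?f z) \<partial>?K)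
      = (\<integral>\<omega>. of_bool (?b (observe d \<omega>, label \<omega>)) * g (?f (observe d \<omega>, label \<omega>)) \<partial>Q)"
      unfolding incomplete_law_def by (rule integral_distr[OF T]) measurable
    also have "\<dots> = (\<integral>\<omega>. of_bool (missing \<omega> \<in> ?U \<and> label \<omega> = k) * g (covariate \<omega> j) \<partial>Q)"
      by (rule Bochner_Integration.integral_cong[OF refl obs_j])
    also have "\<dots> = ?p * (\<integral>x. g (x j) \<partial>mvn d (\<mu> k) \<Sigma>)"
      using on(2) unfolding PU .
    finally show "(\<integral>z. of_bool (?b z) * g (?f z) \<partial>?K) = ?p * (\<integral>x. g (x j) \<partial>mvn d (\<mu> k) \<Sigma>)" .
  qed
  note mom = coordinate_moments[OF mean_dim[OF k] j]
  interpret N: prob_space "mvn d (\<mu> k) \<Sigma>" by (rule prob_space_mvn[OF mean_dim[OF k]])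
  have p: "?p = measure ?K {z \<in> space ?K. ?b z}"
  proof -
    have "measure ?K {z \<in> space ?K. ?b z} = (\<integral>z. indicator {z \<in> space ?K. ?b z} z \<partial>?K)"
      by (simp, intro arg_cong[where f = K.prob]) auto
    also have "\<dots> = (\<integral>z. of_bool (?b z) * 1 \<partial>?K)"
      by (intro Bochner_Integration.integral_cong) (auto simp: indicator_def)
    also have "\<dots> = ?p * (\<integral>x. 1 \<partial>mvn d (\<mu> k) \<Sigma>)"
      by (rule pull(2)) simp_all
    also have "\<dots> = ?p" using N.prob_space by simp
    finally show ?thesis ..
  qed
  have est: "mu_hat n D k j = (\<Sum>i<n. ?f (D i) * of_bool (?b (D i))) / (\<Sum>i<n. of_bool (?b (D i)))" for D
    unfolding mu_hat_def by (simp add: of_bool_conj mult.assoc)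
  have b': "Measurable.pred ?K ?b" and f': "?f \<in> borel_measurable ?K"
    using b f by (simp_all add: measurable_cong_sets[OF sets_incomplete_law refl])
  have m1: "integrable ?K (\<lambda>z. of_bool (?b z) * (?f z - ?c))"
    and m2: "integrable ?K (\<lambda>z. of_bool (?b z) * (?f z - ?c)\<^sup>2)"
    by (rule pull(1)[of "\<lambda>t. t - ?c", OF _ mom(1)], simp) (rule pull(1)[of "\<lambda>t. (t - ?c)\<^sup>2", OF _ mom(3)], simp)
  have v1: "(\<integral>z. of_bool (?b z) * (?f z - ?c) \<partial>?K) = 0"
    by (subst pull(2)[of "\<lambda>t. t - ?c", OF _ mom(1)]) (simp_all add: mom(2))
  have v2: "(\<integral>z. of_bool (?b z) * (?f z - ?c)\<^sup>2 \<partial>?K) = ?p * \<Sigma> $$ (j, j)"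
    by (subst pull(2)[of "\<lambda>t. (t - ?c)\<^sup>2", OF _ mom(3)]) (simp_all add: mom(4))
  note mse = observed_mean_mse[OF prob_space_incomplete_law b' f' p m1 v1 m2 v2 less_imp_le[OF mom(5)], where n = n]
  show "integrable (PiM {..<n} (\<lambda>_. ?K)) (\<lambda>D. (mu_hat n D k j - ?c)\<^sup>2)"
    unfolding est by (rule mse(1))
  have "?p * (\<integral>D. (mu_hat n D k j - ?c)\<^sup>2 \<partial>PiM {..<n} (\<lambda>_. ?K))
      \<le> ?p * (1 - ?p) ^ n * ?c\<^sup>2 + 2 * \<Sigma> $$ (j, j) / (real n + 1)"
    unfolding est by (rule mse(2))
  moreover have "1 - ?p = (1 + \<eta>) / 2" by (simp add: field_simps)
  moreover have "x * e \<le> x * q * c + 4 * s / r" if "x / 2 * e \<le> x / 2 * q * c + 2 * s / r" for x e q c s r :: real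
    using that by (simp only: times_divide_eq_left times_divide_eq_right[symmetric])
  ultimately show "(1 - \<eta>) * (\<integral>D. (mu_hat n D k j - ?c)\<^sup>2 \<partial>PiM {..<n} (\<lambda>_. ?K))
      \<le> (1 - \<eta>) * ((1 + \<eta>) / 2) ^ n * ?c\<^sup>2 + 4 * \<Sigma> $$ (j, j) / (real n + 1)"
    by (simp only:)
qed

section \<open>Risk of the pattern-by-pattern classifier\<close>

abbreviation pattern_prob :: "mask \<Rightarrow> real" where
  "pattern_prob m \<equiv> prob {\<omega> \<in> space Q. missing \<omega> \<in> {m}}"

lemma singleton_mask_sets: "m \<in> mask_patterns d \<Longrightarrow> {m} \<in> sets (mask_space d)"
  by (simp add: mask_space_eq)

text \<open>
  Within a pattern the classes have weight one half, and the rule errs on class \<open>1\<close> inside the section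
  and on class \<open>-1\<close> outside it.
\<close>

lemma rule_risk_decomposition:
  assumes A [measurable]: "A \<in> sets (obs_space d)"
  shows "prob {\<omega> \<in> space Q. label \<omega> \<noteq> (if observe d \<omega> \<in> A then -1 else 1)}
    = (\<Sum>m\<in>mask_patterns d. pattern_prob m *
        ((1 + (measure (mvn d (\<mu> 1) \<Sigma>) (pattern_section d m A) - measure (mvn d (\<mu> (-1)) \<Sigma>) (pattern_section d m A))) / 2))"
proof -
  let ?S = "\<lambda>m. pattern_section d m A" and ?X = "space (covariate_space d)"
  let ?E1 = "\<lambda>m. {\<omega> \<in> space Q. missing \<omega> \<in> {m} \<and> label \<omega> = 1 \<and> covariate \<omega> \<in> ?S m}"
  let ?E2 = "\<lambda>m. {\<omega> \<in> space Q. missing \<omega> \<in> {m} \<and> label \<omega> = -1 \<and> covariate \<omega> \<in> ?X - ?S m}"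
  have obsA: "observe d \<omega> \<in> A \<longleftrightarrow> covariate \<omega> \<in> ?S (missing \<omega>)" if "\<omega> \<in> space Q" for \<omega>
    using measurable_space[OF covariate_measurable that] by (simp add: pattern_section_def observe_def)
  have meas: "?E1 m \<in> sets Q" "?E2 m \<in> sets Q" if m: "m \<in> mask_patterns d" for m
  proof -
    note [measurable] = pattern_section_measurable[OF m A] singleton_mask_sets[OF m]
    show "?E1 m \<in> sets Q" "?E2 m \<in> sets Q" by measurable
  qed
  have mem: "missing \<omega> \<in> mask_patterns d" "covariate \<omega> \<in> ?X" if "\<omega> \<in> space Q" for \<omega>
    using measurable_space[OF missing_measurable that] measurable_space[OF covariate_measurable that]
    by (simp_all add: space_PiM)
  have err: "{\<omega> \<in> space Q. label \<omega> \<noteq> (if observe d \<omega> \<in> A then -1 else 1)} = (\<Union>m\<in>mask_patterns d. ?E1 m \<union> ?E2 m)"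
  proof (intro Set.set_eqI iffI)
    fix \<omega> assume "\<omega> \<in> {\<omega> \<in> space Q. label \<omega> \<noteq> (if observe d \<omega> \<in> A then -1 else 1)}"
    then have "\<omega> \<in> space Q" "label \<omega> \<noteq> (if covariate \<omega> \<in> ?S (missing \<omega>) then -1 else 1)"
      by (auto simp: obsA)
    then have "\<omega> \<in> ?E1 (missing \<omega>) \<union> ?E2 (missing \<omega>)"
      using label_cases[of \<omega>] mem(2)[of \<omega>] by (auto split: if_splits)
    then show "\<omega> \<in> (\<Union>m\<in>mask_patterns d. ?E1 m \<union> ?E2 m)"
      using mem(1)[OF \<open>\<omega> \<in> space Q\<close>] by (rule UN_I[rotated])
  next
    fix \<omega> assume "\<omega> \<in> (\<Union>m\<in>mask_patterns d. ?E1 m \<union> ?E2 m)"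
    then obtain m where "\<omega> \<in> ?E1 m \<union> ?E2 m" by (rule UN_E)
    then have "\<omega> \<in> space Q" "label \<omega> \<noteq> (if covariate \<omega> \<in> ?S (missing \<omega>) then -1 else 1)"
      by auto
    then show "\<omega> \<in> {\<omega> \<in> space Q. label \<omega> \<noteq> (if observe d \<omega> \<in> A then -1 else 1)}"
      by (simp add: obsA)
  qed
  have "prob (\<Union>m\<in>mask_patterns d. ?E1 m \<union> ?E2 m) = (\<Sum>m\<in>mask_patterns d. prob (?E1 m \<union> ?E2 m))"
  proof (rule finite_measure_finite_Union[OF finite_mask_patterns])
    show "(\<lambda>m. ?E1 m \<union> ?E2 m) ` mask_patterns d \<subseteq> sets Q"
      using meas by (intro image_subsetI sets.Un) auto
    show "disjoint_family_on (\<lambda>m. ?E1 m \<union> ?E2 m) (mask_patterns d)"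
      by (auto simp: disjoint_family_on_def)
  qed
  also have "\<dots> = (\<Sum>m\<in>mask_patterns d. pattern_prob m *
      ((1 + (measure (mvn d (\<mu> 1) \<Sigma>) (?S m) - measure (mvn d (\<mu> (-1)) \<Sigma>) (?S m))) / 2))"
  proof (rule sum.cong)
    fix m assume m: "m \<in> mask_patterns d"
    interpret N: prob_space "mvn d (\<mu> (-1)) \<Sigma>" by (rule prob_space_mvn[OF mean_carrier(2)])
    have S: "?S m \<in> sets (covariate_space d)" by (rule pattern_section_measurable[OF m A])
    have "prob (?E1 m \<union> ?E2 m) = prob (?E1 m) + prob (?E2 m)"
      using meas[OF m] by (intro finite_measure_Union) auto
    also have "prob (?E1 m) = pattern_prob m / 2 * measure (mvn d (\<mu> 1) \<Sigma>) (?S m)"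
      using singleton_mask_sets[OF m] S by (intro prob_mask_label_covariate) auto
    also have "prob (?E2 m) = pattern_prob m / 2 * measure (mvn d (\<mu> (-1)) \<Sigma>) (?X - ?S m)"
      using singleton_mask_sets[OF m] S by (intro prob_mask_label_covariate) auto
    also have "measure (mvn d (\<mu> (-1)) \<Sigma>) (?X - ?S m) = 1 - measure (mvn d (\<mu> (-1)) \<Sigma>) (?S m)"
      using N.prob_compl[of "?S m"] S by simp
    finally show "prob (?E1 m \<union> ?E2 m) = pattern_prob m *
      ((1 + (measure (mvn d (\<mu> 1) \<Sigma>) (?S m) - measure (mvn d (\<mu> (-1)) \<Sigma>) (?S m))) / 2)"
      by (simp add: field_simps)
  qed simp
  finally show ?thesis unfolding err .
qed

lemma pattern_prob_filter_sum:
  "(\<Sum>m\<in>{m \<in> mask_patterns d. R m}. pattern_prob m) = prob {\<omega> \<in> space Q. R (missing \<omega>)}"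
proof -
  have E: "{\<omega> \<in> space Q. missing \<omega> \<in> {m}} \<in> sets Q" if "m \<in> mask_patterns d" for m
    using measurable_sets[OF missing_measurable singleton_mask_sets[OF that]] by (simp add: vimage_def Int_def conj_commute)
  have "(\<Sum>m\<in>{m \<in> mask_patterns d. R m}. pattern_prob m)
    = prob (\<Union>m\<in>{m \<in> mask_patterns d. R m}. {\<omega> \<in> space Q. missing \<omega> \<in> {m}})"
    using E finite_mask_patterns by (intro finite_measure_finite_Union[symmetric]) (auto simp: disjoint_family_on_def)
  also have "(\<Union>m\<in>{m \<in> mask_patterns d. R m}. {\<omega> \<in> space Q. missing \<omega> \<in> {m}}) = {\<omega> \<in> space Q. R (missing \<omega>)}"
    using measurable_space[OF missing_measurable] by (auto simp: space_PiM)
  finally show ?thesis .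
qed

lemma observed_prob_patterns:
  assumes j: "j < d"
  shows "(\<Sum>m\<in>mask_patterns d. if j \<in> obs d m then pattern_prob m else 0) = 1 - \<eta>"
proof -
  have "(\<Sum>m\<in>mask_patterns d. if j \<in> obs d m then pattern_prob m else 0)
    = (\<Sum>m\<in>{m \<in> mask_patterns d. \<not> m j}. pattern_prob m)"
    using finite_mask_patterns j by (intro sum.mono_neutral_cong_right) (auto simp: obs_def)
  then show ?thesis using pattern_prob_filter_sum[of "\<lambda>m. \<not> m j"] observed_prob[OF j] by simp
qed

lemma pattern_prob_sum: "(\<Sum>m\<in>mask_patterns d. pattern_prob m) = 1"
  using pattern_prob_filter_sum[of "\<lambda>_. True"] prob_space by simp

end

lemma sign_measurable [measurable]: "sign \<in> measurable borel (count_space UNIV)"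
  unfolding sign_def[abs_def] by measurable

lemma sign_eq_minus_one_iff: "sign s = -1 \<longleftrightarrow> s < 0"
  by (simp add: sign_def)

lemma sign_cases: "sign s = 1 \<or> sign s = -1"
  by (simp add: sign_def)

lemma mu_hat_measurable:
  assumes j: "j < d"
  shows "(\<lambda>D. mu_hat n D k j) \<in> borel_measurable (PiM {..<n} (\<lambda>_. obs_space d \<Otimes>\<^sub>M label_space))"
proof -
  let ?Z = "obs_space d \<Otimes>\<^sub>M label_space"
  have jd: "j \<in> {..<d}" using j by simp
  have [measurable]: "Measurable.pred (mask_space d) (\<lambda>m. m j)"
    and [measurable]: "(\<lambda>x. x j) \<in> borel_measurable (covariate_space d)"
    by (rule measurable_component_singleton[OF jd])+
  have [measurable]: "Measurable.pred label_space (\<lambda>y. y = k)" by simp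
  have num: "(\<lambda>z. fst (fst z) j * of_bool (snd z = k) * of_bool (\<not> snd (fst z) j) :: real) \<in> borel_measurable ?Z"
    by measurable
  have den: "(\<lambda>z. of_bool (snd z = k) * of_bool (\<not> snd (fst z) j) :: real) \<in> borel_measurable ?Z"
    by measurable
  have comp: "(\<lambda>D. D i) \<in> measurable (PiM {..<n} (\<lambda>_. ?Z)) ?Z" if "i \<in> {..<n}" for i
    by (rule measurable_component_singleton[OF that])
  show ?thesis
    unfolding mu_hat_def
    by (intro borel_measurable_divide borel_measurable_sum measurable_compose[OF comp num] measurable_compose[OF comp den])
qed

context lda_mcar_model
begin

lemma obs_subset: "obs d m \<subseteq> {..<d}"
  by (auto simp: obs_def)

lemma h_hat_pattern_measurable:
  "(\<lambda>p. h_hat_pattern d \<Sigma> n (fst p) m (fst (snd p)))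
    \<in> measurable (PiM {..<n} (\<lambda>_. obs_space d \<Otimes>\<^sub>M label_space) \<Otimes>\<^sub>M obs_space d) (count_space UNIV)"
    (is "_ \<in> measurable ?M _")
proof -
  let ?I = "obs d m"
  let ?B = "inv_mat (submatrix \<Sigma> ?I ?I)"
  let ?u = "\<lambda>p i. mu_hat n (fst p) 1 (pick ?I i) - mu_hat n (fst p) (-1) (pick ?I i)"
  let ?v = "\<lambda>p i. fst (snd p) (pick ?I i) - 1/2 * (mu_hat n (fst p) 1 (pick ?I i) + mu_hat n (fst p) (-1) (pick ?I i))"
  have B: "?B \<in> carrier_mat (card ?I) (card ?I)"
    by (rule inv_mat_spd[OF sym_pos_def_submatrix[OF cov_pos_def obs_subset]])
  have eq: "h_hat_pattern d \<Sigma> n (fst p) m (fst (snd p))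
    = sign (\<Sum>i<card ?I. \<Sum>l<card ?I. ?u p i * ?B $$ (i, l) * ?v p l)" for p
    unfolding h_hat_pattern_def Let_def
    by (subst scalar_prod_mat_sum[OF B]) (auto simp: subvec_def intro!: arg_cong[where f = sign] sum.cong)
  have [measurable]: "(\<lambda>p. mu_hat n (fst p) k (pick ?I i)) \<in> borel_measurable ?M" if "i < card ?I" for k i
    by (rule measurable_compose[OF measurable_fst mu_hat_measurable])
      (rule submatrix_principal(4)[OF cov_pos_def obs_subset that])
  have [measurable]: "(\<lambda>p. fst (snd p) (pick ?I i)) \<in> borel_measurable ?M" if "i < card ?I" for i
    using submatrix_principal(4)[OF cov_pos_def obs_subset that]
    by (intro measurable_compose[OF measurable_snd measurable_compose[OF measurable_fst measurable_component_singleton]]) simp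
  have "(\<lambda>p. \<Sum>i<card ?I. \<Sum>l<card ?I. ?u p i * ?B $$ (i, l) * ?v p l) \<in> borel_measurable ?M"
    by (intro borel_measurable_sum borel_measurable_times borel_measurable_diff borel_measurable_add
      borel_measurable_const) measurable
  then show ?thesis unfolding eq by measurable
qed

lemma h_hat_measurable:
  "(\<lambda>p. h_hat d \<Sigma> n (fst p) (snd p))
    \<in> measurable (PiM {..<n} (\<lambda>_. obs_space d \<Otimes>\<^sub>M label_space) \<Otimes>\<^sub>M obs_space d) (count_space UNIV)"
    (is "_ \<in> measurable ?M _")
  unfolding h_hat_def
proof (rule measurable_compose_countable'[where I = "mask_patterns d" and g = "\<lambda>p. snd (snd p)"])
  show "(\<lambda>p. h_hat_pattern d \<Sigma> n (fst p) m (fst (snd p))) \<in> measurable ?M (count_space UNIV)" for m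
    by (rule h_hat_pattern_measurable)
  show "(\<lambda>p. snd (snd p)) \<in> measurable ?M (count_space (mask_patterns d))"
    unfolding mask_space_eq[symmetric] by measurable
  show "countable (mask_patterns d)" by (intro countable_finite finite_mask_patterns)
qed

definition plug_in_region :: "nat \<Rightarrow> sample \<Rightarrow> obs_point set" where
  "plug_in_region n D = {z \<in> space (obs_space d). h_hat d \<Sigma> n D z = -1}"

lemma plug_in_region_sets:
  assumes D: "D \<in> space (PiM {..<n} (\<lambda>_. obs_space d \<Otimes>\<^sub>M label_space))"
  shows "plug_in_region n D \<in> sets (obs_space d)"
proof -
  have [measurable]: "(\<lambda>z. h_hat d \<Sigma> n D z) \<in> measurable (obs_space d) (count_space UNIV)"
    using measurable_compose[OF measurable_Pair1'[OF D] h_hat_measurable] by simp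
  show ?thesis unfolding plug_in_region_def by measurable
qed

lemma h_hat_eq: "z \<in> space (obs_space d) \<Longrightarrow> h_hat d \<Sigma> n D z = (if z \<in> plug_in_region n D then -1 else 1)"
  using sign_cases by (auto simp: plug_in_region_def h_hat_def h_hat_pattern_def Let_def)

text \<open>
  On each pattern the region of the classifier is the half-space to which \<open>plug_in_excess_le\<close> applies.
\<close>

lemma plug_in_section:
  fixes n :: nat and D :: sample
  assumes m: "m \<in> mask_patterns d"
  defines "a \<equiv> mu_hat n D 1" and "b \<equiv> mu_hat n D (-1)"
  shows "\<exists>w \<in> carrier_vec d. (\<forall>j<d. j \<notin> obs d m \<longrightarrow> w $ j = 0) \<and> (\<forall>j\<in>obs d m. (\<Sigma> *\<^sub>v w) $ j = a j - b j) \<and>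
    pattern_section d m (plug_in_region n D)
      = {x \<in> space (covariate_space d). (\<Sum>j<d. w $ j * (x j - (a j + b j) / 2)) < 0}"
proof -
  let ?I = "obs d m"
  let ?B = "inv_mat (submatrix \<Sigma> ?I ?I)"
  obtain w where w: "w \<in> carrier_vec d" "\<forall>j<d. j \<notin> ?I \<longrightarrow> w $ j = 0" "\<forall>j\<in>?I. (\<Sigma> *\<^sub>v w) $ j = a j - b j"
    and score: "\<And>y. subvec (\<lambda>j. a j - b j) ?I \<bullet> (?B *\<^sub>v subvec y ?I) = (\<Sum>j<d. w $ j * y j)"
    using subvec_score_direction[OF cov_pos_def obs_subset, of m "\<lambda>j. a j - b j"] by blast
  have "h_hat d \<Sigma> n D (restrict x ?I, m) = sign (\<Sum>j<d. w $ j * (x j - (a j + b j) / 2))" for x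
  proof -
    have 1: "subvec (mu_hat n D 1) ?I - subvec (mu_hat n D (-1)) ?I = subvec (\<lambda>j. a j - b j) ?I"
      by (rule eq_vecI) (auto simp: subvec_def a_def b_def)
    have 2: "subvec (restrict x ?I) ?I - (1/2) \<cdot>\<^sub>v (subvec (mu_hat n D 1) ?I + subvec (mu_hat n D (-1)) ?I)
      = subvec (\<lambda>j. x j - (a j + b j) / 2) ?I"
      using submatrix_principal(3)[OF cov_pos_def obs_subset]
      by (intro eq_vecI) (auto simp: subvec_def a_def b_def)
    show ?thesis
      unfolding h_hat_def h_hat_pattern_def Let_def fst_conv snd_conv 1 2 score ..
  qed
  moreover have "(restrict x ?I, m) \<in> space (obs_space d)" if "x \<in> space (covariate_space d)" for x
    using measurable_space[OF measurable_restrict_obs that, of m] m by (simp add: space_pair_measure space_PiM)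
  ultimately have "pattern_section d m (plug_in_region n D)
      = {x \<in> space (covariate_space d). (\<Sum>j<d. w $ j * (x j - (a j + b j) / 2)) < 0}"
    unfolding pattern_section_def plug_in_region_def by (auto simp: sign_eq_minus_one_iff)
  with w show ?thesis by blast
qed

abbreviation estimation_error :: "nat \<Rightarrow> sample \<Rightarrow> mask \<Rightarrow> int \<Rightarrow> real" where
  "estimation_error n D m k \<equiv> (\<Sum>j\<in>obs d m. (mu_hat n D k j - \<mu> k $ j)\<^sup>2) / lambda_min \<Sigma>"

lemma plug_in_conditional_excess:
  assumes D: "D \<in> space (PiM {..<n} (\<lambda>_. obs_space d \<Otimes>\<^sub>M label_space))" and A [measurable]: "A \<in> sets (obs_space d)"
  shows "prob {\<omega> \<in> space Q. label \<omega> \<noteq> h_hat d \<Sigma> n D (observe d \<omega>)}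
      - prob {\<omega> \<in> space Q. label \<omega> \<noteq> (if observe d \<omega> \<in> A then -1 else 1)}
    \<le> (\<Sum>m\<in>mask_patterns d. pattern_prob m *
        ((sqrt (estimation_error n D m 1) + sqrt (estimation_error n D m (-1))) / sqrt (2 * pi)))"
proof -
  let ?H = "plug_in_region n D"
  note [measurable] = plug_in_region_sets[OF D]
  let ?d = "\<lambda>A m. measure (mvn d (\<mu> 1) \<Sigma>) (pattern_section d m A) - measure (mvn d (\<mu> (-1)) \<Sigma>) (pattern_section d m A)"
  have "{\<omega> \<in> space Q. label \<omega> \<noteq> h_hat d \<Sigma> n D (observe d \<omega>)}
    = {\<omega> \<in> space Q. label \<omega> \<noteq> (if observe d \<omega> \<in> ?H then -1 else 1)}"
    using h_hat_eq[OF measurable_space[OF observe_measurable]] by (intro Collect_cong conj_cong refl) simp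
  then have "prob {\<omega> \<in> space Q. label \<omega> \<noteq> h_hat d \<Sigma> n D (observe d \<omega>)}
      - prob {\<omega> \<in> space Q. label \<omega> \<noteq> (if observe d \<omega> \<in> A then -1 else 1)}
    = (\<Sum>m\<in>mask_patterns d. pattern_prob m * ((1 + ?d ?H m) / 2)) - (\<Sum>m\<in>mask_patterns d. pattern_prob m * ((1 + ?d A m) / 2))"
    using rule_risk_decomposition[OF plug_in_region_sets[OF D]] rule_risk_decomposition[OF A] by simp
  also have "\<dots> = (\<Sum>m\<in>mask_patterns d. pattern_prob m * ((1 + ?d ?H m) / 2) - pattern_prob m * ((1 + ?d A m) / 2))"
    by (rule sum_subtractf[symmetric])
  also have "\<dots> \<le> (\<Sum>m\<in>mask_patterns d. pattern_prob m *
        ((sqrt (estimation_error n D m 1) + sqrt (estimation_error n D m (-1))) / sqrt (2 * pi)))"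
  proof (rule sum_mono)
    fix m assume m: "m \<in> mask_patterns d"
    obtain w where w: "w \<in> carrier_vec d" "\<forall>j<d. j \<notin> obs d m \<longrightarrow> w $ j = 0"
      "\<forall>j\<in>obs d m. (\<Sigma> *\<^sub>v w) $ j = mu_hat n D 1 j - mu_hat n D (-1) j"
      and H: "pattern_section d m ?H
        = {x \<in> space (covariate_space d). (\<Sum>j<d. w $ j * (x j - (mu_hat n D 1 j + mu_hat n D (-1) j) / 2)) < 0}"
      using plug_in_section[OF m] by blast
    have "?d ?H m - ?d A m \<le> 2 * (sqrt (estimation_error n D m 1) + sqrt (estimation_error n D m (-1))) / sqrt (2 * pi)"
      unfolding H using w
      by (intro plug_in_excess_le mean_carrier obs_subset pattern_section_measurable[OF m A])
         (auto intro: pattern_section_cylinder)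
    then have "((1 + ?d ?H m) / 2) - ((1 + ?d A m) / 2)
        \<le> (sqrt (estimation_error n D m 1) + sqrt (estimation_error n D m (-1))) / sqrt (2 * pi)"
      by (simp add: field_simps)
    then show "pattern_prob m * ((1 + ?d ?H m) / 2) - pattern_prob m * ((1 + ?d A m) / 2)
      \<le> pattern_prob m * ((sqrt (estimation_error n D m 1) + sqrt (estimation_error n D m (-1))) / sqrt (2 * pi))"
      unfolding right_diff_distrib[symmetric] by (intro mult_left_mono) auto
  qed
  finally show ?thesis .
qed

text \<open>
  The conditional expectation is measurable with respect to the observation, so the Bayes predictor
  is one of the rules with which \<open>plug_in_conditional_excess\<close> compares the classifier.
\<close>

lemma h_star_factors:
  "\<exists>A \<in> sets (obs_space d). \<forall>\<omega>\<in>space Q. h_star d Q \<omega> = (if observe d \<omega> \<in> A then -1 else 1)"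
proof -
  let ?F = "vimage_algebra (space Q) (observe d) (obs_space d)"
  let ?r = "real_cond_exp Q ?F (\<lambda>\<omega>'. of_int (label \<omega>'))"
  have "{\<omega> \<in> space ?F. ?r \<omega> < 0} \<in> sets ?F" by measurable
  then obtain A where A: "A \<in> sets (obs_space d)" "{\<omega> \<in> space Q. ?r \<omega> < 0} = observe d -` A \<inter> space Q"
    using measurable_space[OF observe_measurable] by (auto simp: sets_vimage_algebra2)
  have "h_star d Q \<omega> = (if observe d \<omega> \<in> A then -1 else 1)" if "\<omega> \<in> space Q" for \<omega>
  proof -
    have "?r \<omega> < 0 \<longleftrightarrow> observe d \<omega> \<in> A" using A(2) that by blast
    then show ?thesis by (auto simp: h_star_def sign_def)
  qed
  with A(1) show ?thesis by blast
qed

abbreviation squared_error :: "nat \<Rightarrow> sample \<Rightarrow> int \<Rightarrow> real" where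
  "squared_error n D k \<equiv> (\<Sum>j<d. (1 - \<eta>) * (mu_hat n D k j - \<mu> k $ j)\<^sup>2) / lambda_min \<Sigma>"

text \<open>
  Coordinate \<open>j\<close> contributes exactly on the patterns that observe it, which have total probability \<open>1 - \<eta>\<close>.
\<close>

lemma mean_estimation_error:
  "(\<Sum>m\<in>mask_patterns d. pattern_prob m * estimation_error n D m k) = squared_error n D k"
proof -
  let ?e = "\<lambda>j. (mu_hat n D k j - \<mu> k $ j)\<^sup>2"
  have "(\<Sum>m\<in>mask_patterns d. pattern_prob m * estimation_error n D m k)
    = (\<Sum>m\<in>mask_patterns d. \<Sum>j<d. (if j \<in> obs d m then pattern_prob m else 0) * ?e j) / lambda_min \<Sigma>"
  proof -
    have "pattern_prob m * (\<Sum>j\<in>obs d m. ?e j) = (\<Sum>j<d. (if j \<in> obs d m then pattern_prob m else 0) * ?e j)" for m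
      unfolding sum_distrib_left using obs_subset by (intro sum.mono_neutral_cong_left) auto
    then show ?thesis by (simp only: times_divide_eq_right sum_divide_distrib[symmetric])
  qed
  also have "(\<Sum>m\<in>mask_patterns d. \<Sum>j<d. (if j \<in> obs d m then pattern_prob m else 0) * ?e j)
    = (\<Sum>j<d. (\<Sum>m\<in>mask_patterns d. if j \<in> obs d m then pattern_prob m else 0) * ?e j)"
    unfolding sum_distrib_right by (rule sum.swap)
  also have "\<dots> = (\<Sum>j<d. (1 - \<eta>) * ?e j)"
    by (intro sum.cong) (simp_all add: observed_prob_patterns)
  finally show ?thesis .
qed

section \<open>The excess risk bound\<close>

lemma mean_square_le_mu_norm:
  assumes "k \<in> {-1, 1}" "j < d"
  shows "(\<mu> k $ j)\<^sup>2 \<le> (mu_norm d \<mu>)\<^sup>2"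
proof -
  have "{\<bar>\<mu> k $ j\<bar> | k j. k \<in> {-1, 1} \<and> j < d} = (\<lambda>(k, j). \<bar>\<mu> k $ j\<bar>) ` ({-1, 1} \<times> {..<d})"
    by auto
  then have "finite {\<bar>\<mu> k $ j\<bar> | k j. k \<in> {-1, 1} \<and> j < d}" by simp
  then have "\<bar>\<mu> k $ j\<bar> \<le> mu_norm d \<mu>"
    unfolding mu_norm_def using assms by (intro Max_ge) blast+
  then show ?thesis by (rule abs_le_square_iff[THEN iffD1, OF order_trans[OF _ abs_ge_self]])
qed

lemma variance_le_kappa:
  assumes "j < d"
  shows "\<Sigma> $$ (j, j) \<le> kappa d \<Sigma> * lambda_min \<Sigma>"
proof -
  have "\<Sigma> $$ (j, j) \<le> Max {\<Sigma> $$ (i, i) | i. i < d}"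
    using assms by (intro Max_ge) auto
  then show ?thesis
    unfolding kappa_def using lambda_min_spd(1)[OF cov_pos_def dim_pos] by simp
qed

lemma kappa_pos: "0 < kappa d \<Sigma>"
proof -
  have "0 < \<Sigma> $$ (0, 0)" using coordinate_moments(5)[OF mean_carrier(1), of 0] dim_pos by simp
  also have "\<dots> \<le> kappa d \<Sigma> * lambda_min \<Sigma>" using dim_pos by (intro variance_le_kappa) simp
  finally show ?thesis using lambda_min_spd(1)[OF cov_pos_def dim_pos] by (simp add: zero_less_mult_iff)
qed

abbreviation sample_law :: "nat \<Rightarrow> sample measure" where
  "sample_law n \<equiv> PiM {..<n} (\<lambda>_. incomplete_law d Q)"

definition mse_bound :: "nat \<Rightarrow> real" where
  "mse_bound n = ((1 + \<eta>) / 2) ^ n * ((mu_norm d \<mu>)\<^sup>2 * real d * (1 - \<eta>) / lambda_min \<Sigma>) + 4 * kappa d \<Sigma> * real d / real n"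

lemma squared_error_mean_le:
  assumes n: "n \<ge> 1" and k: "k \<in> {-1, 1}"
  shows "integrable (sample_law n) (\<lambda>D. squared_error n D k)"
    and "(\<integral>D. squared_error n D k \<partial>sample_law n) \<le> mse_bound n"
proof -
  have lam: "0 < lambda_min \<Sigma>" by (rule lambda_min_spd(1)[OF cov_pos_def dim_pos])
  note int = mu_hat_mse(1)[OF k]
  show "integrable (sample_law n) (\<lambda>D. squared_error n D k)"
    using int by (intro integrable_divide Bochner_Integration.integrable_sum integrable_mult_right) simp
  have "(\<integral>D. squared_error n D k \<partial>sample_law n)
    = (\<Sum>j<d. \<integral>D. (1 - \<eta>) * (mu_hat n D k j - \<mu> k $ j)\<^sup>2 \<partial>sample_law n) / lambda_min \<Sigma>"
    using int by (subst integral_divide_zero, subst Bochner_Integration.integral_sum) simp_all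
  also have "\<dots> = (\<Sum>j<d. (1 - \<eta>) * (\<integral>D. (mu_hat n D k j - \<mu> k $ j)\<^sup>2 \<partial>sample_law n)) / lambda_min \<Sigma>"
    by simp
  also have "\<dots> \<le> (\<Sum>j<d. (1 - \<eta>) * ((1 + \<eta>) / 2) ^ n * (mu_norm d \<mu>)\<^sup>2 + 4 * kappa d \<Sigma> * lambda_min \<Sigma> / real n) / lambda_min \<Sigma>"
  proof (intro divide_right_mono sum_mono)
    fix j assume "j \<in> {..<d}"
    then have j: "j < d" by simp
    have "(1 - \<eta>) * ((1 + \<eta>) / 2) ^ n * (\<mu> k $ j)\<^sup>2 \<le> (1 - \<eta>) * ((1 + \<eta>) / 2) ^ n * (mu_norm d \<mu>)\<^sup>2"
      using eta_range by (intro mult_left_mono mean_square_le_mu_norm[OF k j]) simp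
    moreover have "4 * \<Sigma> $$ (j, j) / (real n + 1) \<le> 4 * (kappa d \<Sigma> * lambda_min \<Sigma>) / real n"
      using n variance_le_kappa[OF j] coordinate_moments(5)[OF mean_carrier(1) j] by (intro frac_le) auto
    ultimately show "(1 - \<eta>) * (\<integral>D. (mu_hat n D k j - \<mu> k $ j)\<^sup>2 \<partial>sample_law n)
      \<le> (1 - \<eta>) * ((1 + \<eta>) / 2) ^ n * (mu_norm d \<mu>)\<^sup>2 + 4 * kappa d \<Sigma> * lambda_min \<Sigma> / real n"
      using mu_hat_mse(2)[OF k j, of n] by (simp only: mult.assoc)
  qed (use lam in simp)
  also have "\<dots> = mse_bound n"
    using lam by (simp add: mse_bound_def add_divide_distrib distrib_left mult_ac)
  finally show "(\<integral>D. squared_error n D k \<partial>sample_law n) \<le> mse_bound n" .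
qed

lemma mse_bound_pos: "n \<ge> 1 \<Longrightarrow> 0 < mse_bound n"
  unfolding mse_bound_def using kappa_pos dim_pos eta_range lambda_min_spd(1)[OF cov_pos_def dim_pos]
  by (intro add_nonneg_pos) auto

text \<open>
  The inequality \<open>sqrt t \<le> c / 2 + t / (2 * c)\<close> stands in for Jensen's inequality: it is an equality for
  \<open>t = c\<^sup>2\<close>, and nothing is lost when \<open>c\<^sup>2\<close> is chosen as the bound on the expectation of \<open>t\<close>.
\<close>

lemma average_sqrt_error_le:
  assumes c: "0 < c"
  shows "(\<Sum>m\<in>mask_patterns d. pattern_prob m *
        ((sqrt (estimation_error n D m 1) + sqrt (estimation_error n D m (-1))) / sqrt (2 * pi)))
    \<le> (c + (squared_error n D 1 + squared_error n D (-1)) / (2 * c)) / sqrt (2 * pi)"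
proof -
  have amgm: "sqrt t \<le> c / 2 + t / (2 * c)" if t: "0 \<le> t" for t
  proof -
    have "0 \<le> (sqrt t - c)\<^sup>2" by simp
    also have "\<dots> = t - 2 * c * sqrt t + c\<^sup>2" using t by (simp add: power2_diff)
    finally have "2 * c * sqrt t \<le> t + c\<^sup>2" by simp
    then show ?thesis using c by (simp add: field_simps power2_eq_square)
  qed
  have nonneg: "0 \<le> estimation_error n D m k" for m k
    using lambda_min_spd(1)[OF cov_pos_def dim_pos] by (intro divide_nonneg_pos sum_nonneg) auto
  have "(\<Sum>m\<in>mask_patterns d. pattern_prob m *
        ((sqrt (estimation_error n D m 1) + sqrt (estimation_error n D m (-1))) / sqrt (2 * pi)))
    \<le> (\<Sum>m\<in>mask_patterns d. pattern_prob m *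
        ((c + (estimation_error n D m 1 + estimation_error n D m (-1)) / (2 * c)) / sqrt (2 * pi)))"
  proof (intro sum_mono mult_left_mono divide_right_mono)
    fix m
    show "sqrt (estimation_error n D m 1) + sqrt (estimation_error n D m (-1))
      \<le> c + (estimation_error n D m 1 + estimation_error n D m (-1)) / (2 * c)"
      using amgm[OF nonneg, of 1 m] amgm[OF nonneg, of "-1" m] by (simp only: add_divide_distrib)
  qed auto
  also have "\<dots> = (\<Sum>m\<in>mask_patterns d. (pattern_prob m * c
        + (pattern_prob m * estimation_error n D m 1 + pattern_prob m * estimation_error n D m (-1)) / (2 * c)) / sqrt (2 * pi))"
    by (simp only: times_divide_eq_right distrib_left)
  also have "\<dots> = ((\<Sum>m\<in>mask_patterns d. pattern_prob m) * c
     + ((\<Sum>m\<in>mask_patterns d. pattern_prob m * estimation_error n D m 1)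
      + (\<Sum>m\<in>mask_patterns d. pattern_prob m * estimation_error n D m (-1))) / (2 * c)) / sqrt (2 * pi)"
    by (simp only: sum_divide_distrib[symmetric] sum.distrib sum_distrib_right[symmetric])
  finally show ?thesis unfolding mean_estimation_error pattern_prob_sum by simp
qed

theorem excess_risk_le:
  assumes n: "n \<ge> 1"
  shows "risk_h_hat d \<Sigma> n Q - risk_h_star d Q \<le> 2 / sqrt (2 * pi) * sqrt (mse_bound n)"
proof -
  \<comment> \<open>the value of \<open>c\<close> that balances the two terms of \<open>average_sqrt_error_le\<close>\<close>
  define c where "c = sqrt (mse_bound n)"
  have c: "0 < c" and c2: "c * c = mse_bound n" using mse_bound_pos[OF n] by (simp_all add: c_def)
  obtain A where A [measurable]: "A \<in> sets (obs_space d)"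
    and hA: "\<forall>\<omega>\<in>space Q. h_star d Q \<omega> = (if observe d \<omega> \<in> A then -1 else 1)"
    using h_star_factors by blast
  have star: "risk_h_star d Q = prob {\<omega> \<in> space Q. label \<omega> \<noteq> (if observe d \<omega> \<in> A then -1 else 1)}"
    unfolding risk_h_star_def using hA by (intro arg_cong[where f = prob] Collect_cong conj_cong refl) simp
  interpret K: prob_space "incomplete_law d Q" by (rule prob_space_incomplete_law)
  interpret S: prob_space "sample_law n" by (intro prob_space_PiM) (rule prob_space_incomplete_law)
  interpret SQ: pair_prob_space "sample_law n" Q ..
  have sets_S: "sets (sample_law n) = sets (PiM {..<n} (\<lambda>_. obs_space d \<Otimes>\<^sub>M label_space))"
    by (intro sets_PiM_cong) simp_all
  have space_S: "space (sample_law n) = space (PiM {..<n} (\<lambda>_. obs_space d \<Otimes>\<^sub>M label_space))"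
    by (rule sets_eq_imp_space_eq[OF sets_S])
  let ?P = "sample_law n \<Otimes>\<^sub>M Q"
  let ?E = "{p \<in> space ?P. label (snd p) \<noteq> h_hat d \<Sigma> n (fst p) (observe d (snd p))}"
  let ?r = "\<lambda>D. prob {\<omega> \<in> space Q. label \<omega> \<noteq> h_hat d \<Sigma> n D (observe d \<omega>)}"
  let ?V = "\<lambda>D. squared_error n D 1 + squared_error n D (-1)"
  let ?g = "\<lambda>D. risk_h_star d Q + (c + ?V D / (2 * c)) / sqrt (2 * pi)"
  have g_nonneg: "0 \<le> ?g D" for D
  proof -
    have nn: "0 \<le> squared_error n D k" for k
      using lambda_min_spd(1)[OF cov_pos_def dim_pos] eta_range by (intro divide_nonneg_pos sum_nonneg) auto
    show ?thesis
      using add_nonneg_nonneg[OF nn[of 1] nn[of "-1"]] c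
      by (simp add: risk_h_star_def divide_nonneg_pos)
  qed
  have h [measurable]: "(\<lambda>p. h_hat d \<Sigma> n (fst p) (observe d (snd p))) \<in> measurable ?P (count_space UNIV)"
  proof -
    have "(\<lambda>p. (fst p, observe d (snd p))) \<in> measurable ?P (PiM {..<n} (\<lambda>_. obs_space d \<Otimes>\<^sub>M label_space) \<Otimes>\<^sub>M obs_space d)"
      by (intro measurable_Pair measurable_compose[OF measurable_snd observe_measurable])
        (simp add: measurable_cong_sets[OF refl sets_S[symmetric]])
    from measurable_compose[OF this h_hat_measurable] show ?thesis by simp
  qed
  have l [measurable]: "(\<lambda>p. label (snd p)) \<in> measurable ?P (count_space UNIV)"
    by (rule measurable_compose[OF measurable_compose[OF measurable_snd label_measurable]]) simp
  have E: "?E \<in> sets ?P" by measurable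
  have "ennreal (risk_h_hat d \<Sigma> n Q) = emeasure ?P ?E"
    unfolding risk_h_hat_def Let_def SQ.emeasure_eq_measure
    by (intro arg_cong[where f = "\<lambda>S. ennreal (measure ?P S)"]) auto
  also have "\<dots> = (\<integral>\<^sup>+D. emeasure Q (Pair D -` ?E) \<partial>sample_law n)"
    by (rule emeasure_pair_measure_alt[OF E])
  also have "\<dots> = (\<integral>\<^sup>+D. ennreal (?r D) \<partial>sample_law n)"
  proof (rule nn_integral_cong)
    fix D assume "D \<in> space (sample_law n)"
    then have "Pair D -` ?E = {\<omega> \<in> space Q. label \<omega> \<noteq> h_hat d \<Sigma> n D (observe d \<omega>)}"
      by (auto simp: space_pair_measure)
    then show "emeasure Q (Pair D -` ?E) = ennreal (?r D)" by (simp add: emeasure_eq_measure)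
  qed
  also have "\<dots> \<le> (\<integral>\<^sup>+D. ennreal (?g D) \<partial>sample_law n)"
  proof (intro nn_integral_mono ennreal_leI)
    fix D assume "D \<in> space (sample_law n)"
    then have D: "D \<in> space (PiM {..<n} (\<lambda>_. obs_space d \<Otimes>\<^sub>M label_space))" unfolding space_S .
    show "?r D \<le> ?g D"
      using plug_in_conditional_excess[OF D A] average_sqrt_error_le[OF c, of n D] unfolding star by linarith
  qed
  also have "\<dots> = ennreal (\<integral>D. ?g D \<partial>sample_law n)"
  proof (rule nn_integral_eq_integral)
    show "integrable (sample_law n) ?g"
      using squared_error_mean_le(1)[OF n] by simp
  qed (use g_nonneg in simp)
  finally have "risk_h_hat d \<Sigma> n Q \<le> (\<integral>D. ?g D \<partial>sample_law n)"
    using g_nonneg by (simp add: ennreal_le_iff integral_nonneg_AE)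
  also have "(\<integral>D. ?g D \<partial>sample_law n) = risk_h_star d Q
     + (c + ((\<integral>D. squared_error n D 1 \<partial>sample_law n) + (\<integral>D. squared_error n D (-1) \<partial>sample_law n)) / (2 * c)) / sqrt (2 * pi)"
    using squared_error_mean_le(1)[OF n] S.prob_space by simp
  also have "\<dots> \<le> risk_h_star d Q + (c + (mse_bound n + mse_bound n) / (2 * c)) / sqrt (2 * pi)"
    using squared_error_mean_le(2)[OF n] c
    by (intro add_left_mono divide_right_mono add_mono) auto
  also have "(mse_bound n + mse_bound n) / (2 * c) = c"
    unfolding c2[symmetric] using c by simp
  finally show ?thesis unfolding c_def by (simp add: field_simps)
qed

end

lemma geometric_eventually_le_inverse:
  fixes q B e :: real
  assumes q: "0 \<le> q" "q < 1" and e: "0 < e"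
  shows "\<exists>N. \<forall>n\<ge>N. q ^ n * B \<le> e / real n"
proof -
  have "(\<lambda>n. real n * q ^ n * B) \<longlonglongrightarrow> 0"
    using tendsto_mult_left_zero[OF powser_times_n_limit_0[of q], of B] q by simp
  then have "eventually (\<lambda>n. real n * q ^ n * B < e) sequentially"
    using e by (rule order_tendstoD)
  then obtain N where N: "\<And>n. n \<ge> N \<Longrightarrow> real n * q ^ n * B < e"
    by (auto simp: eventually_sequentially)
  have "q ^ n * B \<le> e / real n" if "n \<ge> max N 1" for n
    using N[of n] that by (simp add: field_simps)
  then show ?thesis by blast
qed

theorem theorem5p6:
  shows "(\<forall>(d::nat) (\<eta>::real) (\<mu>::int \<Rightarrow> real vec) (\<Sigma>::real mat) (Q::full_point measure) (n::nat).
            lda_mcar_model d \<eta> \<mu> \<Sigma> Q \<and> n \<ge> 1 \<longrightarrow>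
              risk_h_hat d \<Sigma> n Q - risk_h_star d Q
              \<le> 2 / sqrt (2 * pi) *
                 sqrt (((1 + \<eta>) / 2) ^ n * ((mu_norm d \<mu>)\<^sup>2 * real d * (1 - \<eta>) / lambda_min \<Sigma>)
                       + 4 * kappa d \<Sigma> * real d / real n))
       \<and> (\<exists>C::real. C > 0 \<and>
            (\<forall>(d::nat) (\<eta>::real) (\<mu>::int \<Rightarrow> real vec) (\<Sigma>::real mat).
               \<exists>N::nat. \<forall>n\<ge>N. \<forall>Q::full_point measure.
                 lda_mcar_model d \<eta> \<mu> \<Sigma> Q \<longrightarrow>
                   risk_h_hat d \<Sigma> n Q - risk_h_star d Q
                   \<le> C * sqrt (kappa d \<Sigma> * real d / real n)))"
proof (intro conjI allI impI exI[of _ "2 / sqrt (2 * pi) * sqrt 5"])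
  fix d \<eta> \<mu> \<Sigma> Q and n :: nat
  assume "lda_mcar_model d \<eta> \<mu> \<Sigma> Q \<and> n \<ge> 1"
  then show "risk_h_hat d \<Sigma> n Q - risk_h_star d Q
      \<le> 2 / sqrt (2 * pi) *
         sqrt (((1 + \<eta>) / 2) ^ n * ((mu_norm d \<mu>)\<^sup>2 * real d * (1 - \<eta>) / lambda_min \<Sigma>)
               + 4 * kappa d \<Sigma> * real d / real n)"
    using lda_mcar_model.excess_risk_le[of d \<eta> \<mu> \<Sigma> Q n]
      lda_mcar_model.mse_bound_def[of d \<eta> \<mu> \<Sigma> Q n] by simp
next
  \<comment> \<open>once the first term of the bound is below \<open>\<kappa> d / n\<close>, the whole is at most \<open>5 \<kappa> d / n\<close>\<close>
  let ?C = "2 / sqrt (2 * pi) * sqrt 5"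
  show "?C > 0" by simp
next
  let ?C = "2 / sqrt (2 * pi) * sqrt 5"
  fix d :: nat and \<eta> :: real and \<mu> :: "int \<Rightarrow> real vec" and \<Sigma> :: "real mat"
  show "\<exists>N::nat. \<forall>n\<ge>N. \<forall>Q::full_point measure. lda_mcar_model d \<eta> \<mu> \<Sigma> Q \<longrightarrow>
     risk_h_hat d \<Sigma> n Q - risk_h_star d Q \<le> ?C * sqrt (kappa d \<Sigma> * real d / real n)"
  proof (cases "\<exists>Q. lda_mcar_model d \<eta> \<mu> \<Sigma> Q")
    case False
    then show ?thesis by blast
  next
    case True
    \<comment> \<open>any instance of the model provides the constraints on the parameters, from which \<open>N\<close> is chosen\<close>
    then obtain Q\<^sub>0 where "lda_mcar_model d \<eta> \<mu> \<Sigma> Q\<^sub>0" ..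
    then interpret M0: lda_mcar_model d \<eta> \<mu> \<Sigma> Q\<^sub>0 .
    let ?B = "(mu_norm d \<mu>)\<^sup>2 * real d * (1 - \<eta>) / lambda_min \<Sigma>" and ?e = "kappa d \<Sigma> * real d"
    have e: "0 < ?e" using M0.kappa_pos M0.dim_pos by simp
    have "\<exists>N. \<forall>n\<ge>N. ((1 + \<eta>) / 2) ^ n * ?B \<le> ?e / real n"
    proof (cases "\<eta> = 1")
      case True
      then show ?thesis using e by (intro exI[of _ 0]) simp
    next
      case False
      then show ?thesis using M0.eta_range e by (intro geometric_eventually_le_inverse) auto
    qed
    then obtain N where N: "\<And>n. n \<ge> N \<Longrightarrow> ((1 + \<eta>) / 2) ^ n * ?B \<le> ?e / real n" by blast
    show ?thesis
    proof (intro exI[of _ "max N 1"] allI impI)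
      fix n Q assume n: "max N 1 \<le> n" and "lda_mcar_model d \<eta> \<mu> \<Sigma> Q"
      then interpret M: lda_mcar_model d \<eta> \<mu> \<Sigma> Q by simp
      have "risk_h_hat d \<Sigma> n Q - risk_h_star d Q \<le> 2 / sqrt (2 * pi) * sqrt (M.mse_bound n)"
        using n by (intro M.excess_risk_le) simp
      also have "\<dots> \<le> 2 / sqrt (2 * pi) * sqrt (5 * (?e / real n))"
        using N[of n] n unfolding M.mse_bound_def by (intro mult_left_mono real_sqrt_le_mono) auto
      also have "\<dots> = ?C * sqrt (?e / real n)"
        by (simp only: real_sqrt_mult mult.assoc)
      finally show "risk_h_hat d \<Sigma> n Q - risk_h_star d Q \<le> ?C * sqrt (?e / real n)" .
    qed
  qed
qed

end
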